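(* Let $m,n$ be positive integers, let $A$ be an arbitrary $m\times n$ integer matrix, and let $\mathcal{L}=\mathrm{Ker}_{\mathbb{Z}}(A)\subset\mathbb{Z}^n$. The universal Markov basis of $A$ is a subset of the universal Gröbner basis of $A$ if and only if one of the following two conditions holds: (1) $\mathcal{L}$ is positive (i.e. $\mathcal{L}\cap\mathbb{N}^n=\{\mathbf{0}\}$) and every element of a Markov fiber is a vertex of a Markov polytope (that is, for every Markov fiber, each of its elements is a vertex of one of the Markov polytopes of that fiber); (2) $\mathcal{L}=\mathcal{L}_{pure}$ and $\mathrm{rank}\,\mathcal{L}=1$.
   Context: $\mathbb{N}$ contains $0$. Each $\mathbf{u}\in\mathbb{Z}^n$ is written uniquely as $\mathbf{u}=\mathbf{u}^+-\mathbf{u}^-$ with $\mathbf{u}^+,\mathbf{u}^-\in\mathbb{N}^n$ of disjoint support. Lattice ideal: $I_{\mathcal{L}}=\langle x^{\mathbf{u}}-x^{\mathbf{v}} : \mathbf{u},\mathbf{v}\in\mathbb{N}^n,\ A\mathbf{u}=A\mathbf{v}\rangle$ in $K[x_1,\dots,x_n]$, $K$ a field. Markov basis of $A$: a finite subset $M\subset\mathcal{L}$ such that any $\mathbf{w},\mathbf{u}\in\mathbb{N}^n$ with $A\mathbf{w}=A\mathbf{u}$ can be connected by moves from $M$ (up to sign, repetitions allowed) with all partial sums remaining in $\mathbb{N}^n$; equivalently, such that $\{x^{\mathbf{u}^+}-x^{\mathbf{u}^-}:\mathbf{u}\in M\}$ generates $I_{\mathcal{L}}$. It is minimal if no proper subset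 of it is a Markov basis. Universal Markov basis of $A$: the union of all minimal Markov bases of $A$ of minimal cardinality. Universal Gröbner basis of $A$: the set of all $\mathbf{u}\in\mathcal{L}$ such that $x^{\mathbf{u}^+}-x^{\mathbf{u}^-}$ is part of a reduced Gröbner basis of $I_{\mathcal{L}}$ for some term order. In both sets a vector $\mathbf{u}$ is identified with $-\mathbf{u}$. $\mathcal{L}_{pure}$ is the sublattice of $\mathcal{L}$ generated by $\mathcal{L}\cap\mathbb{N}^n$. Fiber of $\mathbf{u}\in\mathcal{L}$: $\mathcal{F}_{\mathbf{u}}=\{\mathbf{t}\in\mathbb{N}^n:\mathbf{u}^+-\mathbf{t}\in\mathcal{L}\}$ (finite when $\mathcal{L}$ is positive). The graph $G_{\mathbf{u}}$ has vertex set $\mathcal{F}_{\mathbf{u}}$, and two vertices $\mathbf{w}_1,\mathbf{w}_2$ are joined by an edge if there is an index $i$ such that the $i$-th components of both $\mathbf{w}_1$ and $\mathbf{w}_2$ are nonzero. $\mathcal{F}_{\mathbf{u}}$ is a Markov fiber if there is an element $\mathbf{v}$ of the universal Markov basis of $A$ with $\mathbf{v}^+\in\mathcal{F}_{\mathbf{u}}$. The Markov polyhedra of $\mathcal{F}_{\mathbf{u}}$ are the convex hulls of (the vertex sets of) the connected components of $G_{\mathbf{u}}$; when $\mathcal{L}$ is positive they are polytopes, called Markov polytopes. *)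

theory Defs
  imports "HOL-Analysis.Analysis" "HOL-Library.Poly_Mapping"
begin

definition int_vec :: "nat ^ 'n \<Rightarrow> int ^ 'n"
  where "int_vec t = (\<chi> i. int (t $ i))"

definition real_vec :: "nat ^ 'n \<Rightarrow> real ^ 'n"
  where "real_vec t = (\<chi> i. real (t $ i))"

text \<open>The unique decomposition of an integer vector as a difference of two natural vectors with
  disjoint supports: \<open>u = int_vec (pos_part u) - int_vec (neg_part u)\<close>.\<close>

definition pos_part :: "int ^ 'n \<Rightarrow> nat ^ 'n"
  where "pos_part u = (\<chi> i. nat (u $ i))"

definition neg_part :: "int ^ 'n \<Rightarrow> nat ^ 'n"
  where "neg_part u = (\<chi> i. nat (- (u $ i)))"

lemma pos_part_minus_neg_part: "int_vec (pos_part u) - int_vec (neg_part u) = u"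
  by (simp add: vec_eq_iff int_vec_def pos_part_def neg_part_def)

lemma pos_neg_part_disjoint: "pos_part u $ i = 0 \<or> neg_part u $ i = 0"
  by (auto simp: pos_part_def neg_part_def)

definition kernel_lattice :: "int ^ 'n ^ 'm \<Rightarrow> (int ^ 'n) set"
  where "kernel_lattice A = {u. A *v u = 0}"

definition nonneg_part :: "(int ^ 'n) set \<Rightarrow> (int ^ 'n) set"
  where "nonneg_part L = {u \<in> L. \<forall>i. 0 \<le> u $ i}"

definition positive_lattice :: "(int ^ 'n) set \<Rightarrow> bool"
  where "positive_lattice L \<longleftrightarrow> nonneg_part L = {0}"

global_interpretation int_module: module "(*s) :: int \<Rightarrow> int ^ 'n \<Rightarrow> int ^ 'n"
  by standard (simp_all add: vector_add_ldistrib vector_sadd_rdistrib vector_smult_assoc)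

definition pure_sublattice :: "(int ^ 'n) set \<Rightarrow> (int ^ 'n) set"
  where "pure_sublattice L = int_module.span (nonneg_part L)"

text \<open>The rank of a sublattice of the free abelian group of integer vectors, as the cardinality of
  one of its \<open>\<int>\<close>-bases (which always exist, are finite, and have the same cardinality).\<close>

definition lattice_rank :: "(int ^ 'n) set \<Rightarrow> nat"
  where "lattice_rank L =
    card (SOME B. \<not> int_module.dependent B \<and> int_module.span B = L)"

text \<open>A polynomial over \<open>'k\<close> in variables indexed by \<open>'n\<close> is a finitely supported map from exponent
  vectors to coefficients; multiplication is convolution.\<close>

type_synonym ('n, 'k) polynomial = "nat ^ 'n \<Rightarrow>\<^sub>0 'k"

definition monomial :: "nat ^ 'n \<Rightarrow> ('n::finite, 'k::field) polynomial"
  where "monomial u = Poly_Mapping.single u 1"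

text \<open>Ideals of a commutative ring are its submodules; \<open>ideal.span S\<close> is the ideal generated by \<open>S\<close>.\<close>

global_interpretation ideal: module "(*) :: 'a::comm_ring_1 \<Rightarrow> 'a \<Rightarrow> 'a"
  by standard (simp_all add: algebra_simps)

definition lattice_ideal :: "int ^ 'n ^ 'm \<Rightarrow> ('n::finite, 'k::field) polynomial set"
  where "lattice_ideal A =
    ideal.span {monomial u - monomial v | u v. A *v int_vec u = A *v int_vec v}"

definition binomial_of :: "int ^ 'n \<Rightarrow> ('n::finite, 'k::field) polynomial"
  where "binomial_of u = monomial (pos_part u) - monomial (neg_part u)"

definition term_order :: "(nat ^ 'n) rel \<Rightarrow> bool"
  where "term_order r \<longleftrightarrow> linear_order r \<and> (\<forall>a. (0, a) \<in> r) \<and>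
    (\<forall>a b c. (a, b) \<in> r \<longrightarrow> (a + c, b + c) \<in> r)"

text \<open>The largest exponent occurring in a polynomial; only meaningful for nonzero polynomials.\<close>

definition lead_exp :: "(nat ^ 'n) rel \<Rightarrow> ('n::finite, 'k::field) polynomial \<Rightarrow> nat ^ 'n"
  where "lead_exp r f =
    (THE a. a \<in> Poly_Mapping.keys f \<and> (\<forall>b \<in> Poly_Mapping.keys f. (b, a) \<in> r))"

definition initial_ideal ::
    "(nat ^ 'n) rel \<Rightarrow> ('n::finite, 'k::field) polynomial set \<Rightarrow> ('n, 'k) polynomial set"
  where "initial_ideal r S = ideal.span {monomial (lead_exp r f) | f. f \<in> S \<and> f \<noteq> 0}"

definition groebner_basis ::
    "(nat ^ 'n) rel \<Rightarrow> ('n::finite, 'k::field) polynomial set \<Rightarrow> ('n, 'k) polynomial set \<Rightarrow> bool"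
  where "groebner_basis r I G \<longleftrightarrow>
    finite G \<and> G \<subseteq> I \<and> initial_ideal r G = initial_ideal r I"

definition reduced_groebner_basis ::
    "(nat ^ 'n) rel \<Rightarrow> ('n::finite, 'k::field) polynomial set \<Rightarrow> ('n, 'k) polynomial set \<Rightarrow> bool"
  where "reduced_groebner_basis r I G \<longleftrightarrow> groebner_basis r I G \<and>
    (\<forall>g \<in> G. g \<noteq> 0 \<and> Poly_Mapping.lookup g (lead_exp r g) = 1) \<and>
    (\<forall>g \<in> G. \<forall>h \<in> G - {g}. \<forall>a \<in> Poly_Mapping.keys g.
      \<not> (monomial (lead_exp r h) :: ('n, 'k) polynomial) dvd monomial a)"

text \<open>One move between natural vectors. Since both ends have type \<open>nat ^ 'n\<close>, all intermediate points
  of a chain of moves are automatically nonnegative.\<close>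

definition move_step :: "(int ^ 'n) set \<Rightarrow> nat ^ 'n \<Rightarrow> nat ^ 'n \<Rightarrow> bool"
  where "move_step M w w' \<longleftrightarrow>
    (\<exists>v \<in> M. int_vec w' = int_vec w + v \<or> int_vec w' = int_vec w - v)"

definition markov_basis :: "int ^ 'n ^ 'm \<Rightarrow> (int ^ 'n) set \<Rightarrow> bool"
  where "markov_basis A M \<longleftrightarrow> finite M \<and> M \<subseteq> kernel_lattice A \<and>
    (\<forall>w u. A *v int_vec w = A *v int_vec u \<longrightarrow> (move_step M)\<^sup>*\<^sup>* w u)"

definition minimal_markov_basis :: "int ^ 'n ^ 'm \<Rightarrow> (int ^ 'n) set \<Rightarrow> bool"
  where "minimal_markov_basis A M \<longleftrightarrow>
    markov_basis A M \<and> (\<forall>M'. M' \<subset> M \<longrightarrow> \<not> markov_basis A M')"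

text \<open>Identification of \<open>u\<close> with \<open>-u\<close>: sets of vectors up to sign are represented by
  sets closed under negation.\<close>

definition up_to_sign :: "(int ^ 'n) set \<Rightarrow> (int ^ 'n) set"
  where "up_to_sign S = S \<union> uminus ` S"

definition universal_markov_basis :: "int ^ 'n ^ 'm \<Rightarrow> (int ^ 'n) set"
  where "universal_markov_basis A =
    up_to_sign (\<Union> {M. minimal_markov_basis A M \<and>
      (\<forall>M'. minimal_markov_basis A M' \<longrightarrow> card M \<le> card M')})"

text \<open>The argument of type \<open>'k itself\<close> only fixes the coefficient field.\<close>

definition universal_groebner_basis :: "'k::field itself \<Rightarrow> int ^ 'n ^ 'm \<Rightarrow> (int ^ 'n::finite) set"
  where "universal_groebner_basis K A =
    up_to_sign {u \<in> kernel_lattice A. \<exists>r G. term_order r \<and>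
      reduced_groebner_basis r (lattice_ideal A) G \<and>
      (binomial_of u :: ('n, 'k) polynomial) \<in> G}"

definition fiber :: "(int ^ 'n) set \<Rightarrow> int ^ 'n \<Rightarrow> (nat ^ 'n) set"
  where "fiber L u = {t. int_vec (pos_part u) - int_vec t \<in> L}"

text \<open>The edge relation of the graph on a set \<open>F\<close> of vertices. It also relates every nonzero vertex
  to itself, which does not affect the connected components.\<close>

definition fiber_graph :: "(nat ^ 'n) set \<Rightarrow> (nat ^ 'n) rel"
  where "fiber_graph F =
    {(w\<^sub>1, w\<^sub>2). w\<^sub>1 \<in> F \<and> w\<^sub>2 \<in> F \<and> (\<exists>i. w\<^sub>1 $ i \<noteq> 0 \<and> w\<^sub>2 $ i \<noteq> 0)}"

definition graph_components :: "(nat ^ 'n) set \<Rightarrow> (nat ^ 'n) set set"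
  where "graph_components F = F // (fiber_graph F)\<^sup>*"

definition markov_fiber :: "int ^ 'n ^ 'm \<Rightarrow> int ^ 'n \<Rightarrow> bool"
  where "markov_fiber A u \<longleftrightarrow>
    (\<exists>v \<in> universal_markov_basis A. pos_part v \<in> fiber (kernel_lattice A) u)"

definition markov_polyhedra :: "(int ^ 'n) set \<Rightarrow> int ^ 'n \<Rightarrow> (real ^ 'n) set set"
  where "markov_polyhedra L u =
    (\<lambda>C. convex hull (real_vec ` C)) ` graph_components (fiber L u)"

end

theory Submission
  imports Defs
begin

text \<open>
  A move \<open>u\<close> belongs to the universal Groebner basis iff, up to sign, some term order makes \<open>u\<^sup>-\<close> the least
  element of its fiber and \<open>u\<^sup>+\<close> the least among the elements of the fiber that share a variable
  with \<open>u\<^sup>+\<close>.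

  If the lattice is not positive, a smallest Markov basis contains, up to sign, a nonzero nonnegative
  vector \<open>p\<close>. Any other move \<open>v\<close> in it can be replaced by \<open>v + k p\<close> for every \<open>k\<close>, and for large \<open>k\<close>
  this is not in the universal Groebner basis because \<open>p\<close> divides its positive part. So \<open>p\<close> is the only
  move and generates the lattice.

  If the lattice is positive, there is a strictly positive grading, and the universal Markov basis
  consists of the differences of elements in different components of a fiber. Components have disjoint
  supports, so weights exposing vertices of two components combine, with the help of the grading, to one term
  order as required. Conversely, an element that is least among those sharing a variable with it is a
  vertex of its component: a convex combination would yield a nonnegative integer relation that
  contradicts the additivity of the term order.
\<close>

text \<open>The nonstandard exponents, those that are not least in their fiber, turn out to be the
  exponents of the initial ideal; this turns questions about reduced Groebner bases into comparisons
  of exponents. Least elements also provide a first Markov basis, hence a smallest one. On the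
  Markov side the basic operation is an exchange: a smallest Markov basis stays smallest when a move
  \<open>v\<close> is replaced by one that still allows \<open>neg_part v\<close> and
  \<open>pos_part v\<close> to be joined. The shifted moves and the differences across components
  both enter the universal Markov basis in this way. Such a difference has the two chosen elements
  as its positive and negative part, since different components have disjoint supports; so every
  element of a Markov fiber is a part of some move and can be tested. The obstacle in passing from
  term orders to vertices is that a term order compares natural exponents and comes without a real
  weight, whereas convex combinations have real coefficients. Simultaneous Dirichlet approximation
  bridges this gap, and serves again for the existence of the grading, applied to the columns of
  \<open>A\<close>.\<close>

lemma int_vec_nth [simp]: "int_vec t $ i = int (t $ i)"
  by (simp add: int_vec_def)

lemma int_vec_zero [simp]: "int_vec 0 = 0"
  by (simp add: vec_eq_iff)

lemma int_vec_add [simp]: "int_vec (a + b) = int_vec a + int_vec b"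
  by (simp add: vec_eq_iff)

lemma int_vec_eq_iff [simp]: "int_vec a = int_vec b \<longleftrightarrow> a = b"
  by (simp add: vec_eq_iff)

lemma pos_part_nth [simp]: "pos_part u $ i = nat (u $ i)"
  by (simp add: pos_part_def)

lemma neg_part_nth [simp]: "neg_part u $ i = nat (- (u $ i))"
  by (simp add: neg_part_def)

lemma pos_part_uminus [simp]: "pos_part (- u) = neg_part u"
  by (simp add: vec_eq_iff)

lemma neg_part_uminus [simp]: "neg_part (- u) = pos_part u"
  by (simp add: vec_eq_iff)

lemma pos_part_eq_neg_part_iff: "pos_part u = neg_part u \<longleftrightarrow> u = 0"
  by (auto simp: vec_eq_iff) (metis linorder_le_cases nat_0_iff neg_le_0_iff_le nle_le)

section \<open>Exponent vectors, their supports and their fibers\<close>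

lemma nat_vec_le_iff: "a \<le> b \<longleftrightarrow> (\<exists>s. b = a + s)" for a b :: "nat ^ 'n"
proof
  assume "a \<le> b"
  then have "b = a + (b - a)"
    by (simp add: vec_eq_iff less_eq_vec_def)
  then show "\<exists>s. b = a + s" ..
qed (auto simp: less_eq_vec_def)

text \<open>Division of a monomial by a variable that occurs in it. For two exponents of one fiber
  that share the variable, the quotients again lie in a common fiber, by
  \<open>same_fiber_add_right\<close>.\<close>

lemma nat_vec_unit_add:
  fixes a :: "nat ^ 'n"
  assumes "a $ i \<noteq> 0"
  obtains a' where "a = a' + axis i 1"
proof
  show "a = (a - axis i 1) + axis i 1"
    using assms by (auto simp: vec_eq_iff axis_def)
qed

definition disjoint_support :: "nat ^ 'n \<Rightarrow> nat ^ 'n \<Rightarrow> bool"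
  where "disjoint_support a b \<longleftrightarrow> (\<forall>i. a $ i = 0 \<or> b $ i = 0)"

lemma disjoint_support_sym: "disjoint_support a b \<Longrightarrow> disjoint_support b a"
  unfolding disjoint_support_def by metis

lemma parts_of_diff:
  assumes "disjoint_support a b"
  shows "pos_part (int_vec a - int_vec b) = a" and "neg_part (int_vec a - int_vec b) = b"
proof -
  have "a $ i = 0 \<or> b $ i = 0" for i
    using assms by (simp add: disjoint_support_def)
  then have "nat (int (a $ i) - int (b $ i)) = a $ i \<and> nat (int (b $ i) - int (a $ i)) = b $ i" for i
    by (metis diff_0_right diff_zero nat_int nat_zminus_int of_nat_0 diff_0)
  then show "pos_part (int_vec a - int_vec b) = a" and "neg_part (int_vec a - int_vec b) = b"
    by (simp_all add: vec_eq_iff)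
qed

text \<open>Both ends are natural, so \<open>w\<close> is at least \<open>neg_part v\<close> in
  every coordinate: a step along \<open>v\<close> is a translate of the step from
  \<open>neg_part v\<close> to \<open>pos_part v\<close>.\<close>

lemma move_decompose:
  assumes "int_vec w' = int_vec w + v"
  obtains s where "w = neg_part v + s" "w' = pos_part v + s"
proof
  have "int (w' $ i) = int (w $ i) + v $ i" for i
    using arg_cong[OF assms, of "\<lambda>x. x $ i"] by simp
  note * = this
  show "w = neg_part v + (w - neg_part v)" "w' = pos_part v + (w - neg_part v)"
    using * by (simp_all add: vec_eq_iff) (smt (verit, best) int_nat_eq of_nat_0_le_iff of_nat_add of_nat_diff nat_le_iff of_nat_eq_iff)+
qed

text \<open>An equivalence relation in place of the sets \<open>fiber L u\<close>: it needs no
  representative from the lattice, and translation preserves and reflects it.\<close>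

definition same_fiber :: "int ^ 'n ^ 'm \<Rightarrow> nat ^ 'n \<Rightarrow> nat ^ 'n \<Rightarrow> bool"
  where "same_fiber A a b \<longleftrightarrow> A *v int_vec a = A *v int_vec b"

lemma same_fiber_refl [simp]: "same_fiber A a a"
  by (simp add: same_fiber_def)

lemma same_fiber_sym: "same_fiber A a b \<Longrightarrow> same_fiber A b a"
  by (simp add: same_fiber_def)

lemma same_fiber_trans: "same_fiber A a b \<Longrightarrow> same_fiber A b c \<Longrightarrow> same_fiber A a c"
  by (simp add: same_fiber_def)

lemma same_fiber_add_right [simp]: "same_fiber A (a + s) (b + s) \<longleftrightarrow> same_fiber A a b"
  by (simp add: same_fiber_def matrix_vector_right_distrib)

lemma same_fiber_iff_diff: "same_fiber A a b \<longleftrightarrow> int_vec a - int_vec b \<in> kernel_lattice A"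
  by (simp add: same_fiber_def kernel_lattice_def matrix_vector_mult_diff_distrib)

lemma same_fiber_parts_iff: "same_fiber A (pos_part u) (neg_part u) \<longleftrightarrow> u \<in> kernel_lattice A"
  by (simp add: same_fiber_iff_diff pos_part_minus_neg_part)

lemma mem_fiber_iff: "t \<in> fiber (kernel_lattice A) u \<longleftrightarrow> same_fiber A (pos_part u) t"
  by (simp add: fiber_def same_fiber_iff_diff)

lemma matrix_vector_mult_scale: "A *v (c *s x) = c *s (A *v x)"
  for A :: "'a::comm_semiring_1 ^ 'n ^ 'm"
  by (simp add: vec_eq_iff matrix_vector_mult_def sum_distrib_left mult.left_commute)

lemma kernel_subspace: "int_module.subspace (kernel_lattice A)"
  unfolding int_module.subspace_def
  by (auto simp: kernel_lattice_def matrix_vector_right_distrib matrix_vector_mult_scale)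

lemmas kernel_zero [simp] = int_module.subspace_0[OF kernel_subspace]
  and kernel_add = int_module.subspace_add[OF kernel_subspace]
  and kernel_neg = int_module.subspace_neg[OF kernel_subspace]
  and kernel_scale = int_module.subspace_scale[OF kernel_subspace]

section \<open>Dickson's lemma\<close>

lemma nat_mono_subseq:
  fixes g :: "nat \<Rightarrow> nat"
  obtains \<phi> :: "nat \<Rightarrow> nat" where "strict_mono \<phi>" "mono (g \<circ> \<phi>)"
proof -
  obtain f :: "nat \<Rightarrow> nat" where f: "strict_mono f" "monoseq (\<lambda>n. g (f n))"
    using seq_monosub[of g] by blast
  show thesis
  proof (cases "mono (g \<circ> f)")
    case True
    with f that show thesis by blast
  next
    case False
    then have anti: "g (f n) \<le> g (f m)" if "m \<le> n" for m n
      using f(2) that unfolding monoseq_def mono_def o_def by blast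
    \<comment> \<open>A nonincreasing sequence of naturals is constant from the index of its least
      value on, and a constant tail is monotone.\<close>
    define k where "k = (ARG_MIN (\<lambda>n. g (f n)) n. True)"
    have k: "g (f k) \<le> g (f n)" for n
      unfolding k_def by (rule arg_min_nat_le) simp
    have "strict_mono (\<lambda>n. f (n + k))"
      using f(1) by (simp add: strict_mono_def)
    moreover have "mono (g \<circ> (\<lambda>n. f (n + k)))"
      using k anti[of k] by (metis (mono_tags, lifting) comp_apply le_add2 monoI order_trans)
    ultimately show thesis using that by blast
  qed
qed

lemma dickson_subseq:
  fixes f :: "nat \<Rightarrow> nat ^ 'n"
  obtains \<phi> :: "nat \<Rightarrow> nat" where "strict_mono \<phi>" "mono (f \<circ> \<phi>)"
proof -
  \<comment> \<open>One coordinate at a time: passing to a further subsequence keeps the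
    monotonicity already achieved in the earlier coordinates.\<close>
  have "\<exists>\<phi>::nat \<Rightarrow> nat. strict_mono \<phi> \<and> (\<forall>i\<in>T. mono (\<lambda>k. f (\<phi> k) $ i))" if "finite T" for T :: "'n set"
    using that
  proof (induction T)
    case empty
    show ?case by (rule exI[of _ id]) (simp add: strict_mono_def)
  next
    case (insert i T)
    then obtain \<phi> :: "nat \<Rightarrow> nat" where \<phi>: "strict_mono \<phi>" "\<forall>i\<in>T. mono (\<lambda>k. f (\<phi> k) $ i)" by blast
    obtain \<psi> :: "nat \<Rightarrow> nat" where \<psi>: "strict_mono \<psi>" "mono ((\<lambda>k. f (\<phi> k) $ i) \<circ> \<psi>)"
      by (rule nat_mono_subseq)
    have "mono (\<lambda>k. f ((\<phi> \<circ> \<psi>) k) $ j)" if "j \<in> insert i T" for j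
      using that \<phi>(2) \<psi> strict_mono_mono[OF \<psi>(1)] by (auto simp: mono_def o_def)
    moreover have "strict_mono (\<phi> \<circ> \<psi>)"
      using \<phi>(1) \<psi>(1) by (rule strict_mono_o)
    ultimately show ?case by blast
  qed
  from this[OF finite_class.finite_UNIV] that show thesis
    by (auto simp: mono_def less_eq_vec_def)
qed

lemma dickson:
  fixes f :: "nat \<Rightarrow> nat ^ 'n"
  obtains i j where "i < j" "f i \<le> f j"
proof -
  obtain \<phi> :: "nat \<Rightarrow> nat" where \<phi>: "strict_mono \<phi>" "mono (f \<circ> \<phi>)"
    by (rule dickson_subseq)
  have "\<phi> 0 < \<phi> 1" "f (\<phi> 0) \<le> f (\<phi> 1)"
    using \<phi> by (auto simp: strict_mono_def mono_def)
  then show thesis by (rule that)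
qed

lemma finite_antichain:
  fixes S :: "(nat ^ 'n) set"
  assumes "\<And>x y. x \<in> S \<Longrightarrow> y \<in> S \<Longrightarrow> x \<le> y \<Longrightarrow> x = y"
  shows "finite S"
proof (rule ccontr)
  assume "infinite S"
  then obtain f :: "nat \<Rightarrow> nat ^ 'n" where f: "inj f" "range f \<subseteq> S"
    using infinite_countable_subset by blast
  obtain i j where "i < j" "f i \<le> f j" by (rule dickson)
  moreover have "f i = f j"
    using assms f(2) \<open>f i \<le> f j\<close> by blast
  ultimately show False using f(1) by (simp add: inj_eq)
qed

lemma wf_less_nat_vec: "wf {(a, b :: nat ^ 'n). a < b}"
  unfolding wf_iff_no_infinite_down_chain
proof
  assume "\<exists>f. \<forall>i. (f (Suc i), f i) \<in> {(a, b :: nat ^ 'n). a < b}"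
  then obtain f :: "nat \<Rightarrow> nat ^ 'n" where f: "f (Suc i) < f i" for i by blast
  obtain i j where ij: "i < j" "f i \<le> f j" by (rule dickson)
  have "f (Suc (i + k)) < f i" for k
    by (induction k) (use f in \<open>force intro: less_trans\<close>)+
  then have "f j < f i"
    using ij(1) less_imp_Suc_add by blast
  with ij(2) show False by auto
qed

section \<open>Term orders and standard exponents\<close>

locale term_ord =
  fixes r :: "(nat ^ 'n) rel"
  assumes term_order: "term_order r"
begin

lemma refl [simp]: "(a, a) \<in> r"
  using term_order unfolding term_order_def linear_order_on_def partial_order_on_def preorder_on_def
  by (meson UNIV_I refl_onD)

lemma trans: "(a, b) \<in> r \<Longrightarrow> (b, c) \<in> r \<Longrightarrow> (a, c) \<in> r"
  using term_order unfolding term_order_def linear_order_on_def partial_order_on_def preorder_on_def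
  by (meson transE)

lemma antisym: "(a, b) \<in> r \<Longrightarrow> (b, a) \<in> r \<Longrightarrow> a = b"
  using term_order unfolding term_order_def linear_order_on_def partial_order_on_def
  by (meson antisymD)

lemma total: "(a, b) \<in> r \<or> (b, a) \<in> r"
  using term_order unfolding term_order_def linear_order_on_def total_on_def by (metis UNIV_I refl)

lemma add_right: "(a, b) \<in> r \<Longrightarrow> (a + c, b + c) \<in> r"
  using term_order unfolding term_order_def by blast

lemma add_left: "(a, b) \<in> r \<Longrightarrow> (c + a, c + b) \<in> r"
  using add_right by (simp add: add.commute)

lemma add_right_iff [simp]: "(a + c, b + c) \<in> r \<longleftrightarrow> (a, b) \<in> r"
  by (metis add_right add_right_cancel antisym total)

lemma le_imp: "a \<le> b \<Longrightarrow> (a, b) \<in> r"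
  using term_order add_left[of 0 _ a] unfolding term_order_def nat_vec_le_iff by force

text \<open>A term order extends the componentwise order, so Dickson's lemma excludes infinite
  descent. This gives every fiber, finite or not, a least element.\<close>

lemma wf: "wf (r - Id)"
  unfolding wf_iff_no_infinite_down_chain
proof
  assume "\<exists>f. \<forall>i. (f (Suc i), f i) \<in> r - Id"
  then obtain f where f: "(f (Suc i), f i) \<in> r - Id" for i by blast
  obtain i j where ij: "i < j" "f i \<le> f j" by (rule dickson)
  have "(f (Suc (i + k)), f i) \<in> r - Id" for k
  proof (induction k)
    case (Suc k)
    then show ?case
      using f[of "Suc (i + k)"] trans antisym by (metis DiffD1 DiffD2 DiffI add_Suc_right pair_in_Id_conv)
  qed (use f in simp)
  then have "(f j, f i) \<in> r - Id"
    using ij(1) less_imp_Suc_add by blast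
  with ij(2) show False using le_imp antisym by blast
qed

end

text \<open>For a term order these are the exponents of the standard monomials, those outside the
  initial ideal of the lattice ideal.\<close>

definition standard :: "int ^ 'n ^ 'm \<Rightarrow> (nat ^ 'n) rel \<Rightarrow> nat ^ 'n \<Rightarrow> bool"
  where "standard A r b \<longleftrightarrow> (\<forall>t. same_fiber A b t \<longrightarrow> (b, t) \<in> r)"

text \<open>The exponents of the minimal generators of the initial ideal, which are the leading
  exponents of the reduced Groebner basis.\<close>

definition corners :: "int ^ 'n ^ 'm \<Rightarrow> (nat ^ 'n) rel \<Rightarrow> (nat ^ 'n) set"
  where "corners A r =
    {e. \<not> standard A r e \<and> (\<forall>e'. e' \<le> e \<longrightarrow> \<not> standard A r e' \<longrightarrow> e' = e)}"

definition normal_form :: "int ^ 'n ^ 'm \<Rightarrow> (nat ^ 'n) rel \<Rightarrow> nat ^ 'n \<Rightarrow> nat ^ 'n"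
  where "normal_form A r a = (SOME b. same_fiber A a b \<and> standard A r b)"

lemma finite_corners: "finite (corners A r)"
  by (rule finite_antichain) (auto simp: corners_def)

lemma corner_below:
  assumes "\<not> standard A r a"
  obtains e where "e \<in> corners A r" "e \<le> a"
proof -
  have "a \<in> {e. e \<le> a \<and> \<not> standard A r e}"
    using assms by simp
  from wf_less_nat_vec[unfolded wf_eq_minimal, rule_format, OF this]
  obtain e where e: "e \<in> {e. e \<le> a \<and> \<not> standard A r e}"
    and least: "\<forall>y. (y, e) \<in> {(a, b). a < b} \<longrightarrow> y \<notin> {e. e \<le> a \<and> \<not> standard A r e}"
    by (rule bexE)
  from e have e: "e \<le> a" "\<not> standard A r e"
    by simp_all
  have "e \<in> corners A r"
    unfolding corners_def
  proof (intro CollectI conjI allI impI e(2))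
    fix e' assume "e' \<le> e" "\<not> standard A r e'"
    then show "e' = e"
      using least e(1) by (metis (no_types, lifting) case_prodI mem_Collect_eq order_le_less order_trans)
  qed
  from this e(1) show thesis by (rule that)
qed

context term_ord
begin

lemma standard_unique:
  "standard A r a \<Longrightarrow> standard A r b \<Longrightarrow> same_fiber A a b \<Longrightarrow> a = b"
  unfolding standard_def by (rule antisym) (simp_all add: same_fiber_sym)

lemma normal_form: "same_fiber A a (normal_form A r a)" "standard A r (normal_form A r a)"
proof -
  have "a \<in> {t. same_fiber A a t}"
    by simp
  from wf[unfolded wf_eq_minimal, rule_format, OF this]
  obtain b where b: "b \<in> {t. same_fiber A a t}"
    and least: "\<forall>y. (y, b) \<in> r - Id \<longrightarrow> y \<notin> {t. same_fiber A a t}"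
    by (rule bexE)
  have "(b, t) \<in> r" if "same_fiber A b t" for t
  proof (rule ccontr)
    assume "(b, t) \<notin> r"
    then have "(t, b) \<in> r - Id"
      using total[of b t] by auto
    then show False
      using least b that same_fiber_trans[of A a b t] by simp
  qed
  then have "standard A r b"
    unfolding standard_def by simp
  with b have "\<exists>b. same_fiber A a b \<and> standard A r b"
    by auto
  from someI_ex[OF this]
  show "same_fiber A a (normal_form A r a)" "standard A r (normal_form A r a)"
    unfolding normal_form_def by simp_all
qed

text \<open>If \<open>t\<close> precedes \<open>a\<close> in its fiber, then \<open>t + s\<close>
  precedes \<open>a + s\<close>; the nonstandard exponents are therefore those of a monomial
  ideal.\<close>

lemma nonstandard_mono:
  assumes "\<not> standard A r a" "a \<le> b"
  shows "\<not> standard A r b"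
proof
  assume b: "standard A r b"
  obtain s where s: "b = a + s"
    using assms(2) nat_vec_le_iff by blast
  obtain t where "same_fiber A a t" "(a, t) \<notin> r"
    using assms(1) unfolding standard_def by blast
  then have "same_fiber A b (t + s)" "(b, t + s) \<notin> r"
    using s by simp_all
  with b show False unfolding standard_def by blast
qed

lemma normal_form_less:
  assumes "\<not> standard A r a"
  shows "(normal_form A r a, a) \<in> r - Id"
proof -
  have "normal_form A r a \<noteq> a"
    using assms normal_form(2)[of A a] by auto
  moreover have "(normal_form A r a, a) \<in> r"
    using normal_form(2)[of A a] same_fiber_sym[OF normal_form(1)] unfolding standard_def by blast
  ultimately show ?thesis by auto
qed

end

text \<open>Breaking ties of a nonnegative real weight lexicographically, with respect to an
  enumeration of the coordinates.\<close>

definition lex_less :: "('n \<Rightarrow> nat) \<Rightarrow> nat ^ 'n \<Rightarrow> nat ^ 'n \<Rightarrow> bool"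
  where "lex_less idx a b \<longleftrightarrow> (\<exists>i. a $ i < b $ i \<and> (\<forall>j. idx j < idx i \<longrightarrow> a $ j = b $ j))"

definition weight_order :: "('n \<Rightarrow> nat) \<Rightarrow> real ^ 'n \<Rightarrow> (nat ^ 'n) rel"
  where "weight_order idx c = {(a, b). a = b \<or> c \<bullet> real_vec a < c \<bullet> real_vec b \<or>
    (c \<bullet> real_vec a = c \<bullet> real_vec b \<and> lex_less idx a b)}"

lemma real_vec_nth [simp]: "real_vec t $ i = real (t $ i)"
  by (simp add: real_vec_def)

lemma real_vec_zero [simp]: "real_vec 0 = 0"
  by (simp add: vec_eq_iff)

lemma real_vec_add [simp]: "real_vec (a + b) = real_vec a + real_vec b"
  by (simp add: vec_eq_iff)

lemma real_vec_eq_iff [simp]: "real_vec a = real_vec b \<longleftrightarrow> a = b"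
  by (simp add: vec_eq_iff)

lemma inner_real_vec: "c \<bullet> real_vec t = (\<Sum>i\<in>UNIV. c $ i * real (t $ i))"
  by (simp add: inner_vec_def)

lemma lex_less_total:
  assumes "inj idx" "a \<noteq> b"
  shows "lex_less idx a b \<or> lex_less idx b a"
proof -
  define i where "i = (ARG_MIN idx i. a $ i \<noteq> b $ i)"
  obtain k where k: "a $ k \<noteq> b $ k"
    using assms(2) by (auto simp: vec_eq_iff)
  have "a $ i \<noteq> b $ i"
    unfolding i_def using k by (rule arg_min_natI)
  moreover have "a $ j = b $ j" if "idx j < idx i" for j
    using that arg_min_nat_le[of "\<lambda>i. a $ i \<noteq> b $ i" j idx] unfolding i_def by force
  ultimately show ?thesis
    unfolding lex_less_def by (metis nat_neq_iff)
qed

lemma lex_less_trans: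
  assumes "inj idx" "lex_less idx a b" "lex_less idx b c"
  shows "lex_less idx a c"
proof -
  obtain i k where i: "a $ i < b $ i" "\<And>j. idx j < idx i \<Longrightarrow> a $ j = b $ j"
    and k: "b $ k < c $ k" "\<And>j. idx j < idx k \<Longrightarrow> b $ j = c $ j"
    using assms(2,3) unfolding lex_less_def by blast
  consider "idx i < idx k" | "i = k" | "idx k < idx i"
    using assms(1) by (metis inj_eq linorder_less_linear)
  then show ?thesis
  proof cases
    case 1
    then show ?thesis unfolding lex_less_def using i k by (metis order.strict_trans)
  next
    case 2
    then show ?thesis unfolding lex_less_def using i k by (metis order.strict_trans)
  next
    case 3
    then show ?thesis unfolding lex_less_def using i k by (metis order.strict_trans)
  qed
qed

lemma lex_less_asym: "inj idx \<Longrightarrow> lex_less idx a b \<Longrightarrow> \<not> lex_less idx b a"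
  using lex_less_trans[of idx a b a] by (auto simp: lex_less_def)

lemma lex_less_add: "lex_less idx a b \<Longrightarrow> lex_less idx (a + c) (b + c)"
  unfolding lex_less_def by auto

lemma lex_less_zero: "inj idx \<Longrightarrow> a \<noteq> 0 \<Longrightarrow> lex_less idx 0 a"
  using lex_less_total[of idx 0 a] unfolding lex_less_def by simp

text \<open>Nonnegative weights keep \<open>0\<close> least, and the lexicographic tie-break makes
  the order total when the weights do not separate exponents.\<close>

lemma term_order_weight_order:
  assumes "inj idx" "\<And>i. 0 \<le> c $ i"
  shows "term_order (weight_order idx c)"
proof -
  let ?r = "weight_order idx c"
  have "refl ?r"
    by (rule refl_onI) (auto simp: weight_order_def)
  moreover have "trans ?r"
    by (rule transI) (auto simp: weight_order_def dest: lex_less_trans[OF assms(1)])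
  moreover have "antisym ?r"
    by (rule antisymI) (auto simp: weight_order_def dest: lex_less_asym[OF assms(1)])
  moreover have "total ?r"
    unfolding total_on_def weight_order_def using lex_less_total[OF assms(1)] by force
  moreover have "(0, a) \<in> ?r" for a
  proof -
    have "0 \<le> c \<bullet> real_vec a"
      unfolding inner_real_vec using assms(2) by (simp add: sum_nonneg)
    then show ?thesis
      using lex_less_zero[OF assms(1), of a] by (auto simp: weight_order_def)
  qed
  moreover have "(a + d, b + d) \<in> ?r" if "(a, b) \<in> ?r" for a b d
    using that by (auto simp: weight_order_def inner_add_right lex_less_add)
  ultimately show ?thesis
    unfolding term_order_def linear_order_on_def partial_order_on_def preorder_on_def by simp
qed

lemma ex_index: "\<exists>idx :: 'n::finite \<Rightarrow> nat. inj idx"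
  using finite_imp_inj_to_nat_seg[of "UNIV :: 'n set"] by auto

lemma weight_order_exists:
  fixes c :: "real ^ 'n"
  assumes "\<And>i. 0 \<le> c $ i"
  obtains r where "term_order r"
    "\<And>a b. c \<bullet> real_vec a < c \<bullet> real_vec b \<Longrightarrow> (a, b) \<in> r"
proof -
  obtain idx :: "'n \<Rightarrow> nat" where "inj idx"
    using ex_index by blast
  from term_order_weight_order[OF this assms] show thesis
    by (rule that) (simp add: weight_order_def)
qed

lemma term_order_exists:
  obtains r :: "(nat ^ 'n) rel" where "term_order r"
  using weight_order_exists[of 0] by auto

section \<open>Markov moves\<close>

abbreviation moves_connect :: "(int ^ 'n) set \<Rightarrow> nat ^ 'n \<Rightarrow> nat ^ 'n \<Rightarrow> bool"
  where "moves_connect M \<equiv> (move_step M)\<^sup>*\<^sup>*"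

lemma move_step_sym: "move_step M a b \<Longrightarrow> move_step M b a"
  unfolding move_step_def by (metis add_diff_cancel_right' diff_add_cancel)

lemma move_step_add: "move_step M a b \<Longrightarrow> move_step M (a + s) (b + s)"
  unfolding move_step_def by (force simp: algebra_simps)

lemma move_step_mono: "move_step M a b \<Longrightarrow> M \<subseteq> M' \<Longrightarrow> move_step M' a b"
  unfolding move_step_def by blast

lemma move_stepI: "v \<in> M \<Longrightarrow> move_step M (neg_part v) (pos_part v)"
  unfolding move_step_def using pos_part_minus_neg_part[of v]
  by (metis add.commute diff_add_cancel)

lemma move_step_cases:
  assumes "move_step M a b"
  obtains v s where "v \<in> M" "{a, b} = {pos_part v + s, neg_part v + s}"
proof -
  obtain v where "v \<in> M" and v: "int_vec b = int_vec a + v \<or> int_vec b = int_vec a + (- v)"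
    using assms unfolding move_step_def by auto
  from v show thesis
  proof
    assume "int_vec b = int_vec a + v"
    then obtain s where "a = neg_part v + s" "b = pos_part v + s"
      by (rule move_decompose)
    with \<open>v \<in> M\<close> that show thesis by blast
  next
    assume "int_vec b = int_vec a + (- v)"
    then obtain s where "a = neg_part (- v) + s" "b = pos_part (- v) + s"
      by (rule move_decompose)
    with \<open>v \<in> M\<close> that show thesis by auto
  qed
qed

lemma moves_connect_sym: "moves_connect M a b \<Longrightarrow> moves_connect M b a"
  by (metis move_step_sym symp_rtranclp symp_def)

lemma moves_connect_add: "moves_connect M a b \<Longrightarrow> moves_connect M (a + s) (b + s)"
  by (induction rule: rtranclp_induct) (auto intro: rtranclp.rtrancl_into_rtrancl move_step_add)

lemma moves_connect_mono: "moves_connect M a b \<Longrightarrow> M \<subseteq> M' \<Longrightarrow> moves_connect M' a b"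
  by (metis move_step_mono rtranclp_mono predicate2I rev_predicate2D)

text \<open>Every step along \<open>v\<close> is a translate of the step between its two parts, and
  paths can be translated. Comparing two sets of moves thus reduces to one pair of exponents per
  move.\<close>

lemma moves_connect_simulate:
  assumes "moves_connect M a b"
    and "\<And>v. v \<in> M \<Longrightarrow> moves_connect M' (neg_part v) (pos_part v)"
  shows "moves_connect M' a b"
  using assms(1)
proof (induction rule: rtranclp_induct)
  case (step y z)
  obtain v s where v: "v \<in> M" "{y, z} = {pos_part v + s, neg_part v + s}"
    using step.hyps(2) by (rule move_step_cases)
  have "moves_connect M' (neg_part v + s) (pos_part v + s)"
    using assms(2)[OF v(1)] by (rule moves_connect_add)
  then have "moves_connect M' y z"
    using v(2) moves_connect_sym by (auto simp: doubleton_eq_iff)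
  with step.IH show ?case by (rule rtranclp_trans)
qed simp

lemma move_step_same_fiber:
  assumes "move_step M a b" "M \<subseteq> kernel_lattice A"
  shows "same_fiber A a b"
proof -
  obtain v s where v: "v \<in> M" "{a, b} = {pos_part v + s, neg_part v + s}"
    using assms(1) by (rule move_step_cases)
  have "same_fiber A (pos_part v) (neg_part v)"
    using v(1) assms(2) same_fiber_parts_iff by blast
  then have "same_fiber A (pos_part v + s) (neg_part v + s)"
    by simp
  then show ?thesis
    using v(2) same_fiber_sym by (auto simp: doubleton_eq_iff)
qed

lemma moves_connect_same_fiber:
  assumes "moves_connect M a b" "M \<subseteq> kernel_lattice A"
  shows "same_fiber A a b"
  using assms(1)
  by (induction rule: rtranclp_induct)
    (auto intro: same_fiber_trans move_step_same_fiber[OF _ assms(2)])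

lemma moves_connect_span:
  assumes "moves_connect M a b"
  shows "int_vec b - int_vec a \<in> int_module.span M"
  using assms
proof (induction rule: rtranclp_induct)
  case base
  show ?case by (simp add: int_module.span_zero)
next
  case (step y z)
  then obtain v where "v \<in> M" "int_vec z = int_vec y + v \<or> int_vec z = int_vec y - v"
    unfolding move_step_def by blast
  then have "int_vec z - int_vec y \<in> int_module.span M"
    by (auto simp: int_module.span_base int_module.span_neg)
  from int_module.span_add[OF this step.IH] show ?case by simp
qed

lemma markov_basis_def':
  "markov_basis A M \<longleftrightarrow> finite M \<and> M \<subseteq> kernel_lattice A \<and>
    (\<forall>w u. same_fiber A w u \<longrightarrow> moves_connect M w u)"
  by (simp add: markov_basis_def same_fiber_def)

lemma markov_basis_connect: "markov_basis A M \<Longrightarrow> same_fiber A a b \<Longrightarrow> moves_connect M a b"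
  by (simp add: markov_basis_def')

lemma markov_basis_simulate:
  assumes "markov_basis A M" "finite M'" "M' \<subseteq> kernel_lattice A"
    and "\<And>v. v \<in> M \<Longrightarrow> moves_connect M' (neg_part v) (pos_part v)"
  shows "markov_basis A M'"
  using assms moves_connect_simulate unfolding markov_basis_def' by metis

text \<open>The moves are read off a Groebner basis. A nonstandard exponent lies above a corner, and
  the move of that corner leads to a strictly smaller exponent of the same fiber; well-founded
  induction ends at the least element, which is common to the whole fiber.\<close>

lemma markov_basis_exists:
  fixes A :: "int ^ 'n ^ 'm"
  obtains M where "markov_basis A M"
proof -
  obtain r :: "(nat ^ 'n) rel" where "term_order r"
    by (rule term_order_exists)
  then interpret term_ord r by unfold_locales
  define M where "M = (\<lambda>e. int_vec e - int_vec (normal_form A r e)) ` corners A r"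
  have "finite M"
    unfolding M_def using finite_corners by blast
  moreover have "M \<subseteq> kernel_lattice A"
    unfolding M_def using normal_form(1) same_fiber_iff_diff by blast
  moreover have reduce: "moves_connect M a (normal_form A r a)" for a
    using wf
  proof (induction a rule: wf_induct_rule)
    case (less a)
    show ?case
    proof (cases "standard A r a")
      case True
      then show ?thesis
        using standard_unique[OF _ normal_form(2) normal_form(1)] by (metis rtranclp.rtrancl_refl)
    next
      case False
      then obtain e where e: "e \<in> corners A r" "e \<le> a"
        by (rule corner_below)
      then obtain s where s: "a = e + s"
        using nat_vec_le_iff by blast
      let ?b = "normal_form A r e + s"
      have "\<not> standard A r e"
        using e(1) by (simp add: corners_def)
      from normal_form_less[OF this] have "(?b, a) \<in> r - Id"
        using s by auto
      then have "moves_connect M ?b (normal_form A r ?b)"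
        by (rule less.IH)
      moreover have "normal_form A r ?b = normal_form A r a"
      proof (rule standard_unique[OF normal_form(2) normal_form(2)])
        have "same_fiber A a ?b"
          using s normal_form(1) by simp
        then show "same_fiber A (normal_form A r ?b) (normal_form A r a)"
          by (meson normal_form(1) same_fiber_sym same_fiber_trans)
      qed
      moreover have "move_step M e (normal_form A r e)"
        unfolding move_step_def M_def using e(1) by force
      then have "move_step M a ?b"
        using move_step_add s by blast
      ultimately show ?thesis
        by (metis converse_rtranclp_into_rtranclp)
    qed
  qed
  moreover have "moves_connect M w u" if "same_fiber A w u" for w u
  proof -
    have "normal_form A r w = normal_form A r u"
      using that standard_unique[OF normal_form(2) normal_form(2)]
      by (meson normal_form(1) same_fiber_sym same_fiber_trans)
    then show ?thesis
      using reduce moves_connect_sym by (metis rtranclp_trans)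
  qed
  ultimately have "markov_basis A M"
    unfolding markov_basis_def' by blast
  then show thesis by (rule that)
qed

text \<open>The competition is among all Markov bases instead of the minimal ones, so that an
  exchange need not re-establish minimality. \<open>universal_markov_basis_eq\<close> shows that the
  same sets result.\<close>

definition smallest_markov_basis :: "int ^ 'n ^ 'm \<Rightarrow> (int ^ 'n) set \<Rightarrow> bool"
  where "smallest_markov_basis A M \<longleftrightarrow>
    markov_basis A M \<and> (\<forall>M'. markov_basis A M' \<longrightarrow> card M \<le> card M')"

lemma smallest_markov_basis_exists:
  obtains M where "smallest_markov_basis A M"
proof -
  obtain M\<^sub>0 where M0: "markov_basis A M\<^sub>0"
    by (rule markov_basis_exists)
  show thesis
  proof (rule that)
    show "smallest_markov_basis A (ARG_MIN card M. markov_basis A M)"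
      unfolding smallest_markov_basis_def
      using arg_min_natI[of "markov_basis A", OF M0] arg_min_nat_le[of "markov_basis A"] by blast
  qed
qed

lemma smallest_markov_basis_minimal:
  assumes "smallest_markov_basis A M"
  shows "minimal_markov_basis A M"
proof -
  have "finite M"
    using assms unfolding smallest_markov_basis_def markov_basis_def by blast
  then show ?thesis
    using assms unfolding smallest_markov_basis_def minimal_markov_basis_def
    by (meson leD psubset_card_mono)
qed

lemma minimal_markov_basis_below:
  assumes "markov_basis A M"
  obtains M' where "M' \<subseteq> M" "minimal_markov_basis A M'"
proof -
  have "finite M"
    using assms by (simp add: markov_basis_def)
  then have "\<exists>M'\<subseteq>M. minimal_markov_basis A M'"
    using assms
  proof (induction M rule: finite_psubset_induct)
    case (psubset M)
    show ?case
    proof (cases "minimal_markov_basis A M")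
      case False
      then obtain M' where "M' \<subset> M" "markov_basis A M'"
        using psubset.prems unfolding minimal_markov_basis_def by blast
      with psubset.IH show ?thesis by (meson psubset_imp_subset subset_trans)
    qed blast
  qed
  with that show thesis by blast
qed

text \<open>Every Markov basis contains a minimal one of at most its cardinality, and a Markov basis
  of least cardinality is minimal.\<close>

lemma universal_markov_basis_eq:
  "universal_markov_basis A = up_to_sign (\<Union> {M. smallest_markov_basis A M})"
proof -
  have "minimal_markov_basis A M \<and> (\<forall>M'. minimal_markov_basis A M' \<longrightarrow> card M \<le> card M')
      \<longleftrightarrow> smallest_markov_basis A M" for M
  proof
    assume L: "minimal_markov_basis A M \<and> (\<forall>M'. minimal_markov_basis A M' \<longrightarrow> card M \<le> card M')"
    have "card M \<le> card M'" if "markov_basis A M'" for M'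
    proof -
      obtain M'' where "M'' \<subseteq> M'" "minimal_markov_basis A M''"
        using \<open>markov_basis A M'\<close> by (rule minimal_markov_basis_below)
      moreover have "finite M'"
        using that by (simp add: markov_basis_def)
      ultimately show ?thesis
        using L card_mono order_trans by metis
    qed
    then show "smallest_markov_basis A M"
      using L unfolding smallest_markov_basis_def minimal_markov_basis_def by blast
  next
    assume "smallest_markov_basis A M"
    then show "minimal_markov_basis A M \<and> (\<forall>M'. minimal_markov_basis A M' \<longrightarrow> card M \<le> card M')"
      using smallest_markov_basis_minimal
      unfolding smallest_markov_basis_def minimal_markov_basis_def by blast
  qed
  then show ?thesis
    unfolding universal_markov_basis_def by simp
qed

lemma up_to_sign_iff: "u \<in> up_to_sign S \<longleftrightarrow> u \<in> S \<or> - u \<in> S"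
  unfolding up_to_sign_def by (metis Un_iff image_iff minus_minus)

section \<open>Reduced Groebner bases of lattice ideals\<close>

lemma lookup_monomial [simp]: "Poly_Mapping.lookup (monomial u) a = (if a = u then 1 else 0)"
  by (simp add: monomial_def lookup_single when_def)

lemma keys_monomial [simp]: "Poly_Mapping.keys (monomial u) = {u}"
  by (simp add: monomial_def)

lemma monomial_mult: "monomial a * monomial b = monomial (a + b)"
  by (simp add: monomial_def mult_single)

lemma keys_monomial_diff: "a \<noteq> b \<Longrightarrow> Poly_Mapping.keys (monomial a - monomial b) = {a, b}"
  by (auto simp: in_keys_iff lookup_minus split: if_splits)

lemma monomial_dvd_monomial_iff:
  "(monomial a :: ('n::finite, 'k::field) polynomial) dvd monomial b \<longleftrightarrow> a \<le> b"
proof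
  assume "(monomial a :: ('n, 'k) polynomial) dvd monomial b"
  then obtain q :: "('n, 'k) polynomial" where q: "monomial b = monomial a * q"
    by (rule dvdE)
  have "b \<in> Poly_Mapping.keys (monomial a * q)"
    using q[symmetric] by simp
  then obtain s where "b = a + s"
    using keys_mult[of "monomial a" q] by auto
  then show "a \<le> b"
    using nat_vec_le_iff by blast
next
  assume "a \<le> b"
  then obtain s where "b = a + s"
    using nat_vec_le_iff by blast
  then show "(monomial a :: ('n, 'k) polynomial) dvd monomial b"
    by (metis dvd_triv_left monomial_mult)
qed

lemma sum_single_lookup:
  "(\<Sum>a\<in>Poly_Mapping.keys f. Poly_Mapping.single a (Poly_Mapping.lookup f a)) = f"
proof (rule poly_mapping_eqI)
  fix k
  have "(\<Sum>a\<in>Poly_Mapping.keys f. Poly_Mapping.lookup f a when a = k)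
      = (\<Sum>a\<in>Poly_Mapping.keys f. if a = k then Poly_Mapping.lookup f a else 0)"
    by (simp add: when_def)
  also have "\<dots> = Poly_Mapping.lookup f k"
    by (simp add: in_keys_iff)
  finally show "Poly_Mapping.lookup (\<Sum>a\<in>Poly_Mapping.keys f.
      Poly_Mapping.single a (Poly_Mapping.lookup f a)) k = Poly_Mapping.lookup f k"
    by (simp add: lookup_sum lookup_single)
qed

text \<open>The sum of the coefficients over each fiber is a linear invariant that vanishes on the lattice
  ideal; it forces leading exponents of elements of the ideal to be nonstandard.\<close>

definition fiber_sum :: "int ^ 'n ^ 'm \<Rightarrow> int ^ 'm \<Rightarrow> ('n, 'k::field) polynomial \<Rightarrow> 'k"
  where "fiber_sum A y f =
    (\<Sum>a\<in>Poly_Mapping.keys f. if A *v int_vec a = y then Poly_Mapping.lookup f a else 0)"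

lemma fiber_sum_superset:
  assumes "finite S" "Poly_Mapping.keys f \<subseteq> S"
  shows "fiber_sum A y f = (\<Sum>a\<in>S. if A *v int_vec a = y then Poly_Mapping.lookup f a else 0)"
  unfolding fiber_sum_def using assms
  by (intro sum.mono_neutral_left) (auto simp: in_keys_iff)

lemma fiber_sum_zero [simp]: "fiber_sum A y 0 = 0"
  by (simp add: fiber_sum_def)

lemma fiber_sum_add: "fiber_sum A y (f + g) = fiber_sum A y f + fiber_sum A y g"
proof -
  let ?S = "Poly_Mapping.keys f \<union> Poly_Mapping.keys g"
  have "finite ?S" "Poly_Mapping.keys (f + g) \<subseteq> ?S"
    by (simp_all add: keys_add)
  then show ?thesis
    by (subst (1 2 3) fiber_sum_superset[of ?S])
      (auto simp: lookup_add sum.distrib[symmetric] intro!: sum.cong)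
qed

lemma fiber_sum_sum: "fiber_sum A y (sum g S) = (\<Sum>s\<in>S. fiber_sum A y (g s))"
  by (induction S rule: infinite_finite_induct) (simp_all add: fiber_sum_add)

lemma fiber_sum_single [simp]:
  "fiber_sum A y (Poly_Mapping.single a c) = (if A *v int_vec a = y then c else 0)"
  by (cases "c = 0") (simp_all add: fiber_sum_def)

text \<open>Multiplication by a monomial translates fibers. This is why the sums over all fibers
  must vanish together to define an ideal.\<close>

lemma fiber_sum_single_mult:
  "fiber_sum A y (Poly_Mapping.single s c * f) = c * fiber_sum A (y - A *v int_vec s) f"
proof -
  have "Poly_Mapping.single s c * f =
      Poly_Mapping.single s c * (\<Sum>a\<in>Poly_Mapping.keys f. Poly_Mapping.single a (Poly_Mapping.lookup f a))"
    by (simp add: sum_single_lookup)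
  also have "\<dots> = (\<Sum>a\<in>Poly_Mapping.keys f. Poly_Mapping.single (s + a) (c * Poly_Mapping.lookup f a))"
    by (simp add: sum_distrib_left mult_single)
  finally have eq: "Poly_Mapping.single s c * f = \<dots>" .
  show ?thesis
    unfolding eq fiber_sum_sum fiber_sum_def[of A "y - _" f] sum_distrib_left
    by (rule sum.cong) (auto simp: matrix_vector_right_distrib algebra_simps)
qed

lemma fiber_sum_lattice_ideal:
  fixes f :: "('n::finite, 'k::field) polynomial"
  assumes "f \<in> lattice_ideal A"
  shows "fiber_sum A y f = 0"
proof -
  let ?T = "{f :: ('n, 'k) polynomial. \<forall>y. fiber_sum A y f = 0}"
  have "fiber_sum A y (c * f) = 0" if "f \<in> ?T" for c f y
  proof -
    have "c * f = (\<Sum>s\<in>Poly_Mapping.keys c. Poly_Mapping.single s (Poly_Mapping.lookup c s) * f)"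
      by (subst (1) sum_single_lookup[of c, symmetric]) (simp add: sum_distrib_right)
    with that show ?thesis
      by (simp add: fiber_sum_sum fiber_sum_single_mult)
  qed
  then have "ideal.subspace ?T"
    unfolding ideal.subspace_def by (simp add: fiber_sum_add)
  moreover have "fiber_sum A y (monomial u - monomial v :: ('n, 'k) polynomial) = 0"
    if "A *v int_vec u = A *v int_vec v" for u v y
  proof -
    have "monomial u - monomial v =
        Poly_Mapping.single u (1::'k) + Poly_Mapping.single v (- 1)"
      unfolding monomial_def by (metis diff_conv_add_uminus single_uminus)
    with that show ?thesis
      by (simp add: fiber_sum_add)
  qed
  ultimately have "lattice_ideal A \<subseteq> ?T"
    unfolding lattice_ideal_def by (intro ideal.span_minimal) auto
  with assms show ?thesis by blast
qed

lemma binomial_in_lattice_ideal: "same_fiber A a b \<Longrightarrow> monomial a - monomial b \<in> lattice_ideal A"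
  unfolding lattice_ideal_def same_fiber_def by (rule ideal.span_base) blast

lemma keys_monomial_ideal:
  fixes f :: "('n::finite, 'k::field) polynomial"
  assumes "f \<in> ideal.span (monomial ` E)" "a \<in> Poly_Mapping.keys f"
  obtains e where "e \<in> E" "e \<le> a"
proof -
  let ?T = "{f :: ('n, 'k) polynomial. \<forall>a\<in>Poly_Mapping.keys f. \<exists>e\<in>E. e \<le> a}"
  have "ideal.subspace ?T"
  proof (rule ideal.subspaceI)
    fix f g :: "('n, 'k) polynomial"
    assume "f \<in> ?T" "g \<in> ?T"
    then show "f + g \<in> ?T"
      using keys_add[of f g] by blast
  next
    fix c f :: "('n, 'k) polynomial"
    assume f: "f \<in> ?T"
    have "\<exists>e\<in>E. e \<le> a" if a: "a \<in> Poly_Mapping.keys (c * f)" for a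
    proof -
      obtain s b where b: "a = s + b" "b \<in> Poly_Mapping.keys f"
        using a keys_mult[of c f] by blast
      then obtain e where "e \<in> E" "e \<le> b"
        using f by blast
      moreover have "b \<le> a"
        using b(1) nat_vec_le_iff by (metis add.commute)
      ultimately show ?thesis
        by (meson order_trans)
    qed
    then show "c * f \<in> ?T" by blast
  qed simp
  moreover have "monomial ` E \<subseteq> ?T" by auto
  ultimately have "ideal.span (monomial ` E) \<subseteq> ?T"
    by (intro ideal.span_minimal)
  with assms that show thesis by blast
qed

section \<open>Initial ideals and the elements of reduced Groebner bases\<close>

lemma initial_ideal_eq:
  "initial_ideal r S = ideal.span (monomial ` {lead_exp r f | f. f \<in> S \<and> f \<noteq> 0})"
  unfolding initial_ideal_def by (rule arg_cong[of _ _ ideal.span]) blast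

text \<open>The leading exponent \<open>a\<close> and the tail \<open>b\<close> of an element of the
  reduced Groebner basis. The last clause encodes that \<open>a\<close> is minimal among the
  nonstandard exponents: a proper divisor of \<open>a\<close> that is nonstandard, multiplied back
  up to \<open>a\<close>, produces an element of the fiber that precedes \<open>a\<close> and shares
  a variable with it.\<close>

definition groebner_pair :: "int ^ 'n ^ 'm \<Rightarrow> (nat ^ 'n) rel \<Rightarrow> nat ^ 'n \<Rightarrow> nat ^ 'n \<Rightarrow> bool"
  where "groebner_pair A r a b \<longleftrightarrow> same_fiber A a b \<and> a \<noteq> b \<and> standard A r b \<and>
    (\<forall>t. same_fiber A a t \<longrightarrow> \<not> disjoint_support a t \<longrightarrow> (a, t) \<in> r)"

context term_ord
begin

lemma lead_exp_eqI:
  assumes "a \<in> Poly_Mapping.keys f" "\<And>b. b \<in> Poly_Mapping.keys f \<Longrightarrow> (b, a) \<in> r"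
  shows "lead_exp r f = a"
  unfolding lead_exp_def by (rule the_equality) (use assms antisym in blast)+

lemma lead_exp_mem:
  fixes f :: "('n, 'k::field) polynomial"
  assumes "f \<noteq> 0"
  shows "lead_exp r f \<in> Poly_Mapping.keys f"
    and "\<And>b. b \<in> Poly_Mapping.keys f \<Longrightarrow> (b, lead_exp r f) \<in> r"
proof -
  have ex: "\<exists>a\<in>K. \<forall>b\<in>K. (b, a) \<in> r" if "finite K" "K \<noteq> {}" for K
    using that
  proof (induction K rule: finite_ne_induct)
    case (insert x K)
    then obtain a where a: "a \<in> K" "\<forall>b\<in>K. (b, a) \<in> r" by blast
    show ?case
    proof (cases "(x, a) \<in> r")
      case True
      with a show ?thesis by blast
    next
      case False
      then have "(a, x) \<in> r" using total by blast
      with a trans show ?thesis by (intro bexI[of _ x]) auto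
    qed
  qed simp
  obtain a where a: "a \<in> Poly_Mapping.keys f" "\<forall>b\<in>Poly_Mapping.keys f. (b, a) \<in> r"
    using ex[of "Poly_Mapping.keys f"] assms by auto
  then have "lead_exp r f = a"
    by (intro lead_exp_eqI) auto
  with a show "lead_exp r f \<in> Poly_Mapping.keys f"
    and "\<And>b. b \<in> Poly_Mapping.keys f \<Longrightarrow> (b, lead_exp r f) \<in> r"
    by auto
qed

lemma lead_exp_binomial:
  assumes "a \<noteq> b" "(b, a) \<in> r"
  shows "lead_exp r (monomial a - monomial b :: ('n, 'k::field) polynomial) = a"
  by (rule lead_exp_eqI) (use assms in \<open>auto simp: keys_monomial_diff\<close>)

text \<open>A standard leading exponent is both the largest of the exponents of \<open>f\<close> and
  the least of its fiber, so no other exponent of \<open>f\<close> lies in that fiber. The fiber sum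
  would then be the leading coefficient, which is not zero.\<close>

lemma lead_exp_lattice_ideal_nonstandard:
  fixes f :: "('n, 'k::field) polynomial"
  assumes "f \<in> lattice_ideal A" "f \<noteq> 0"
  shows "\<not> standard A r (lead_exp r f)"
proof
  let ?a = "lead_exp r f"
  assume std: "standard A r ?a"
  have "b = ?a" if "b \<in> Poly_Mapping.keys f" "A *v int_vec b = A *v int_vec ?a" for b
  proof (rule antisym)
    show "(b, ?a) \<in> r"
      using lead_exp_mem(2)[OF assms(2) that(1)] .
    show "(?a, b) \<in> r"
      using std that(2) unfolding standard_def same_fiber_def by simp
  qed
  then have "fiber_sum A (A *v int_vec ?a) f =
      (\<Sum>b\<in>Poly_Mapping.keys f. if b = ?a then Poly_Mapping.lookup f b else 0)"
    unfolding fiber_sum_def by (intro sum.cong) auto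
  also have "\<dots> = Poly_Mapping.lookup f ?a"
    using lead_exp_mem(1)[OF assms(2)] by simp
  finally show False
    using fiber_sum_lattice_ideal[OF assms(1), of "A *v int_vec ?a"] lead_exp_mem(1)[OF assms(2)]
    by (simp add: in_keys_iff)
qed

text \<open>As \<open>c\<close> lies in the initial ideal, some leading exponent of \<open>G\<close>
  divides it and hence divides the exponent \<open>k\<close> of \<open>g\<close>; reducedness
  permits this only for \<open>g\<close> itself. With \<open>c\<close> the tail, or \<open>c\<close>
  a proper divisor of the leading exponent, a contradiction follows.\<close>

lemma reduced_groebner_basis_lead_le:
  fixes G :: "('n, 'k::field) polynomial set"
  assumes G: "reduced_groebner_basis r (lattice_ideal A) G" and g: "g \<in> G"
    and k: "k \<in> Poly_Mapping.keys g" "c \<le> k" and c: "\<not> standard A r c"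
  shows "lead_exp r g \<le> c"
proof -
  obtain t where "same_fiber A c t" and ct: "(c, t) \<notin> r"
    using c unfolding standard_def by blast
  let ?f = "monomial c - monomial t :: ('n, 'k) polynomial"
  have ne: "c \<noteq> t" and "(t, c) \<in> r"
    using ct total[of c t] by auto
  then have "lead_exp r ?f = c"
    by (intro lead_exp_binomial)
  moreover have "?f \<in> lattice_ideal A" "?f \<noteq> 0"
    using binomial_in_lattice_ideal[OF \<open>same_fiber A c t\<close>] keys_monomial_diff[OF ne, where 'b = 'k]
    by fastforce+
  ultimately have "monomial c \<in> initial_ideal r (lattice_ideal A :: ('n, 'k) polynomial set)"
    unfolding initial_ideal_eq by (intro ideal.span_base) force
  then have "(monomial c :: ('n, 'k) polynomial) \<in> initial_ideal r G"
    using G unfolding reduced_groebner_basis_def groebner_basis_def by simp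
  then obtain e where "e \<in> {lead_exp r f | f. f \<in> G \<and> f \<noteq> 0}" "e \<le> c"
    unfolding initial_ideal_eq by (rule keys_monomial_ideal[where a = c]) simp_all
  then obtain h where h: "h \<in> G" "lead_exp r h \<le> c"
    by blast
  have "lead_exp r h \<le> k"
    using h(2) k(2) by (rule order_trans)
  then have "h = g"
    using G g h(1) k(1)
    unfolding reduced_groebner_basis_def monomial_dvd_monomial_iff by blast
  with h(2) show ?thesis by simp
qed

lemma reduced_groebner_basis_pair:
  fixes G :: "('n, 'k::field) polynomial set"
  assumes G: "reduced_groebner_basis r (lattice_ideal A) G" and g: "g \<in> G"
    and keys: "Poly_Mapping.keys g = {a, b}" "a \<noteq> b" "(b, a) \<in> r" and ab: "same_fiber A a b"
  shows "groebner_pair A r a b"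
  unfolding groebner_pair_def
proof (intro conjI allI impI ab keys(2))
  have lead: "lead_exp r g = a"
    by (rule lead_exp_eqI) (use keys in auto)
  show "standard A r b"
  proof (rule ccontr)
    assume "\<not> standard A r b"
    then have "a \<le> b"
      using reduced_groebner_basis_lead_le[OF G g, of b b] keys(1) lead by simp
    then show False
      using keys(2,3) le_imp antisym by blast
  qed
  fix t
  assume t: "same_fiber A a t" "\<not> disjoint_support a t"
  then obtain i where "a $ i \<noteq> 0" "t $ i \<noteq> 0"
    unfolding disjoint_support_def by blast
  then obtain a' t' where a': "a = a' + axis i 1" "t = t' + axis i 1"
    by (metis nat_vec_unit_add)
  show "(a, t) \<in> r"
  proof (rule ccontr)
    assume "(a, t) \<notin> r"
    \<comment> \<open>Cancelling the shared variable preserves both the fiber relation and the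
      comparison, so \<open>t'\<close> shows that the proper divisor \<open>a'\<close> of
      \<open>a\<close> is nonstandard.\<close>
    then have "\<not> standard A r a'"
      using t(1) a' unfolding standard_def by auto
    moreover have "a' \<le> a"
      using a'(1) nat_vec_le_iff by blast
    ultimately have "a \<le> a'"
      using reduced_groebner_basis_lead_le[OF G g, of a a'] keys(1) lead by simp
    then have "a $ i \<le> a' $ i"
      by (simp add: less_eq_vec_def)
    then show False
      using a'(1) by simp
  qed
qed

text \<open>Corners do not divide each other, and none divides a normal form because multiples of
  corners are nonstandard. This supplies the Groebner basis needed to realize a given pair of
  exponents.\<close>

lemma reduced_groebner_basis_corners:
  "reduced_groebner_basis r (lattice_ideal A)
    ((\<lambda>e. monomial e - monomial (normal_form A r e) :: ('n, 'k::field) polynomial) ` corners A r)"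
  (is "reduced_groebner_basis r _ (?g ` _)")
proof -
  have nonstd: "\<not> standard A r e" if "e \<in> corners A r" for e
    using that by (simp add: corners_def)
  have ne: "e \<noteq> normal_form A r e" if "e \<in> corners A r" for e
    using normal_form_less[OF nonstd[OF that]] by auto
  have keys: "Poly_Mapping.keys (?g e) = {e, normal_form A r e}" if "e \<in> corners A r" for e
    using ne[OF that] by (rule keys_monomial_diff)
  have lead: "lead_exp r (?g e) = e" if "e \<in> corners A r" for e
    using normal_form_less[OF nonstd[OF that]] by (intro lead_exp_binomial) auto
  have nz: "?g e \<noteq> 0" if "e \<in> corners A r" for e
    using keys[OF that] by fastforce
  have sub: "?g ` corners A r \<subseteq> lattice_ideal A"
    using binomial_in_lattice_ideal normal_form(1) by blast
  have "initial_ideal r (?g ` corners A r) = initial_ideal r (lattice_ideal A)"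
  proof (rule equalityI)
    show "initial_ideal r (?g ` corners A r) \<subseteq> initial_ideal r (lattice_ideal A)"
      unfolding initial_ideal_def using sub by (intro ideal.span_mono) blast
    have "monomial (lead_exp r f) \<in> initial_ideal r (?g ` corners A r)"
      if f: "f \<in> lattice_ideal A" "f \<noteq> 0" for f :: "('n, 'k) polynomial"
    proof -
      obtain e where e: "e \<in> corners A r" "e \<le> lead_exp r f"
        using lead_exp_lattice_ideal_nonstandard[OF f] by (rule corner_below)
      then obtain s where s: "lead_exp r f = s + e"
        using nat_vec_le_iff by (metis add.commute)
      have "(monomial e :: ('n, 'k) polynomial) \<in> initial_ideal r (?g ` corners A r)"
        unfolding initial_ideal_def using e(1) lead[OF e(1)] nz[OF e(1)]
        by (intro ideal.span_base) (metis (mono_tags, lifting) imageI mem_Collect_eq)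
      then show ?thesis
        unfolding s monomial_mult[symmetric] initial_ideal_def by (rule ideal.span_scale)
    qed
    then show "initial_ideal r (lattice_ideal A) \<subseteq> initial_ideal r (?g ` corners A r)"
      unfolding initial_ideal_def[of r "lattice_ideal A"]
      by (intro ideal.span_minimal) (auto simp: initial_ideal_def)
  qed
  then have "groebner_basis r (lattice_ideal A) (?g ` corners A r)"
    unfolding groebner_basis_def using sub finite_corners by blast
  moreover have "\<not> e' \<le> a"
    if "e \<in> corners A r" "e' \<in> corners A r" "?g e' \<noteq> ?g e" "a \<in> Poly_Mapping.keys (?g e)" for e e' a
  proof
    assume "e' \<le> a"
    have "a = e \<or> a = normal_form A r e"
      using that(4) keys[OF that(1)] by blast
    then show False
    proof
      assume "a = e"
      then have "e' = e"
        using \<open>e' \<le> a\<close> that(1) nonstd[OF that(2)] unfolding corners_def by blast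
      with that(3) show False by simp
    next
      assume "a = normal_form A r e"
      then show False
        using \<open>e' \<le> a\<close> nonstandard_mono[OF nonstd[OF that(2)]] normal_form(2) by blast
    qed
  qed
  ultimately show ?thesis
    unfolding reduced_groebner_basis_def monomial_dvd_monomial_iff
    using nz lead ne by (auto simp: lookup_minus)
qed

lemma groebner_pair_corner:
  assumes "groebner_pair A r a b"
  shows "a \<in> corners A r" and "normal_form A r a = b"
proof -
  have ab: "same_fiber A a b" "a \<noteq> b" "standard A r b"
    and nb: "\<And>t. same_fiber A a t \<Longrightarrow> \<not> disjoint_support a t \<Longrightarrow> (a, t) \<in> r"
    using assms by (auto simp: groebner_pair_def)
  show "normal_form A r a = b"
    using standard_unique[OF normal_form(2) ab(3)] ab(1)
    by (meson normal_form(1) same_fiber_sym same_fiber_trans)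
  have "e' = a" if e': "e' \<le> a" "\<not> standard A r e'" for e'
  proof (rule ccontr)
    assume "e' \<noteq> a"
    obtain s where s: "a = e' + s"
      using e'(1) nat_vec_le_iff by blast
    with \<open>e' \<noteq> a\<close> have "s \<noteq> 0" by auto
    then obtain i where "s $ i \<noteq> 0"
      by (auto simp: vec_eq_iff)
    obtain t where "same_fiber A e' t" "(e', t) \<notin> r"
      using e'(2) unfolding standard_def by blast
    then have "same_fiber A a (t + s)" "(a, t + s) \<notin> r"
      using s by simp_all
    \<comment> \<open>The cofactor \<open>s\<close> occurs in both exponents, so they share the
      variable \<open>i\<close>.\<close>
    moreover have "\<not> disjoint_support a (t + s)"
      using s \<open>s $ i \<noteq> 0\<close> unfolding disjoint_support_def by (metis add_is_0 vector_add_component)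
    ultimately show False
      using nb by blast
  qed
  moreover have "\<not> standard A r a"
    using standard_unique[OF _ ab(3) ab(1)] ab(2) by blast
  ultimately show "a \<in> corners A r"
    unfolding corners_def by blast
qed

end

lemma universal_groebner_basis_iff:
  fixes A :: "int ^ 'n ^ 'm"
  shows "u \<in> universal_groebner_basis TYPE('k::field) A \<longleftrightarrow>
    (\<exists>r. term_order r \<and>
      (groebner_pair A r (pos_part u) (neg_part u) \<or> groebner_pair A r (neg_part u) (pos_part u)))"
proof -
  let ?P = "\<lambda>v. v \<in> kernel_lattice A \<and> (\<exists>r G. term_order r \<and>
      reduced_groebner_basis r (lattice_ideal A) G \<and> (binomial_of v :: ('n, 'k) polynomial) \<in> G)"
  let ?Q = "\<lambda>v. \<exists>r. term_order r \<and>
      (groebner_pair A r (pos_part v) (neg_part v) \<or> groebner_pair A r (neg_part v) (pos_part v))"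
  have PQ: "?Q v" if v: "?P v" for v
  proof -
    obtain r :: "(nat ^ 'n) rel" and G :: "('n, 'k) polynomial set" where "term_order r"
      and G: "reduced_groebner_basis r (lattice_ideal A) G" "binomial_of v \<in> G"
      and vA: "v \<in> kernel_lattice A"
      using v by blast
    then interpret term_ord r by unfold_locales
    have "(binomial_of v :: ('n, 'k) polynomial) \<noteq> 0"
      using G unfolding reduced_groebner_basis_def by blast
    then have "pos_part v \<noteq> neg_part v"
      unfolding binomial_of_def by auto
    moreover from this have "Poly_Mapping.keys (binomial_of v :: ('n, 'k) polynomial)
        = {pos_part v, neg_part v}"
      unfolding binomial_of_def by (rule keys_monomial_diff)
    moreover have "same_fiber A (pos_part v) (neg_part v)"
      using vA same_fiber_parts_iff by blast
    ultimately show ?thesis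
      using reduced_groebner_basis_pair[OF G, of "pos_part v" "neg_part v"]
        reduced_groebner_basis_pair[OF G, of "neg_part v" "pos_part v"]
        total[of "pos_part v" "neg_part v"] \<open>term_order r\<close> same_fiber_sym
      by (metis insert_commute)
  qed
  \<comment> \<open>Leading coefficients are 1, so only this orientation gives
    \<open>binomial_of v\<close> itself. The other one is obtained by applying the fact to
    \<open>- v\<close>, which \<open>up_to_sign\<close> admits.\<close>
  have P: "?P v" if "term_order r" "groebner_pair A r (pos_part v) (neg_part v)" for v r
  proof -
    interpret term_ord r using that(1) by unfold_locales
    have "binomial_of v = (monomial (pos_part v) - monomial (normal_form A r (pos_part v)) :: ('n, 'k) polynomial)"
      using groebner_pair_corner(2)[OF that(2)] by (simp add: binomial_of_def)
    moreover have "v \<in> kernel_lattice A"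
      using that(2) unfolding groebner_pair_def same_fiber_parts_iff by blast
    ultimately show ?thesis
      using groebner_pair_corner(1)[OF that(2)] reduced_groebner_basis_corners that(1) by blast
  qed
  have "u \<in> universal_groebner_basis TYPE('k) A \<longleftrightarrow> ?P u \<or> ?P (- u)"
    unfolding universal_groebner_basis_def up_to_sign_iff by simp
  also have "\<dots> \<longleftrightarrow> ?Q u"
  proof
    assume "?P u \<or> ?P (- u)"
    then show "?Q u"
      using PQ[of u] PQ[of "- u"] by auto
  next
    assume "?Q u"
    then show "?P u \<or> ?P (- u)"
      using P[of _ u] P[of _ "- u"] by auto
  qed
  finally show ?thesis .
qed

section \<open>Minimality and exchange\<close>

lemma minimal_markov_basis_removal:
  assumes "minimal_markov_basis A M" "v \<in> M"
  shows "\<not> moves_connect (M - {v}) (neg_part v) (pos_part v)"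
proof
  assume conn: "moves_connect (M - {v}) (neg_part v) (pos_part v)"
  have M: "markov_basis A M"
    using assms(1) by (simp add: minimal_markov_basis_def)
  have "markov_basis A (M - {v})"
  proof (rule markov_basis_simulate[OF M])
    show "finite (M - {v})" "M - {v} \<subseteq> kernel_lattice A"
      using M unfolding markov_basis_def by blast+
    show "moves_connect (M - {v}) (neg_part w) (pos_part w)" if "w \<in> M" for w
    proof (cases "w = v")
      case False
      then show ?thesis
        using that by (intro r_into_rtranclp move_stepI) simp
    qed (use conn in simp)
  qed
  moreover have "M - {v} \<subset> M"
    using assms(2) by blast
  ultimately show False
    using assms(1) unfolding minimal_markov_basis_def by blast
qed

text \<open>Exchanging one move for one move cannot increase the cardinality, so being a Markov
  basis is all that has to be checked, and \<open>conn\<close> gives this by simulation.\<close>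

lemma smallest_markov_basis_replace:
  assumes M: "smallest_markov_basis A M" and v: "v \<in> M" and v': "v' \<in> kernel_lattice A"
    and conn: "moves_connect (insert v' (M - {v})) (neg_part v) (pos_part v)"
  shows "smallest_markov_basis A (insert v' (M - {v}))"
proof -
  let ?M = "insert v' (M - {v})"
  have basis: "markov_basis A M" and least: "\<And>M'. markov_basis A M' \<Longrightarrow> card M \<le> card M'"
    using M by (auto simp: smallest_markov_basis_def)
  have fin: "finite M" and sub: "M \<subseteq> kernel_lattice A"
    using basis unfolding markov_basis_def by blast+
  have "markov_basis A ?M"
  proof (rule markov_basis_simulate[OF basis])
    show "finite ?M" "?M \<subseteq> kernel_lattice A"
      using fin sub v' by auto
    show "moves_connect ?M (neg_part w) (pos_part w)" if "w \<in> M" for w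
    proof (cases "w = v")
      case False
      then show ?thesis
        using that by (intro r_into_rtranclp move_stepI) simp
    qed (use conn in simp)
  qed
  moreover have "card ?M \<le> card M"
    using fin v by (metis card.insert_remove card_insert_le_m1 card_Diff_singleton
        card_gt_0_iff empty_iff le_refl finite_Diff)
  ultimately show ?thesis
    using least unfolding smallest_markov_basis_def by (metis order_trans)
qed

lemma zero_notin_smallest_markov_basis:
  assumes "smallest_markov_basis A M"
  shows "0 \<notin> M"
  using minimal_markov_basis_removal[OF smallest_markov_basis_minimal[OF assms], of 0]
    pos_part_eq_neg_part_iff[of 0] by (metis rtranclp.rtrancl_refl)

section \<open>Lattices that are not positive\<close>

lemma moves_connect_scale: "moves_connect M 0 q \<Longrightarrow> moves_connect M 0 (k *s q)" for k :: nat
proof (induction k)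
  case 0
  then show ?case by (simp add: vec_eq_iff)
next
  case (Suc k)
  have "Suc k *s q = k *s q + q"
    by (simp add: vec_eq_iff)
  moreover have "moves_connect M (0 + q) (k *s q + q)"
    using Suc by (intro moves_connect_add)
  ultimately show ?case
    using Suc.prems by (metis add_0 rtranclp_trans)
qed

lemma int_vec_scale: "int_vec (k *s q) = int k *s int_vec q"
  by (simp add: vec_eq_iff)

lemma nonneg_int_vec: "(\<And>i. 0 \<le> z $ i) \<Longrightarrow> int_vec (pos_part z) = z"
  by (simp add: vec_eq_iff)

text \<open>The fiber of \<open>0\<close> contains a nonzero exponent. A path from \<open>0\<close>
  to it must take a first step from \<open>0\<close> to a natural vector, so the move used there has
  only one sign.\<close>

lemma ex_nonneg_move:
  assumes M: "smallest_markov_basis A M" and L: "\<not> positive_lattice (kernel_lattice A)"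
  obtains p q where "p \<in> M" "q \<noteq> 0" "p = int_vec q \<or> p = - int_vec q"
proof -
  have "0 \<in> nonneg_part (kernel_lattice A)"
    by (simp add: nonneg_part_def)
  then obtain z where z: "z \<in> nonneg_part (kernel_lattice A)" "z \<noteq> 0"
    using L unfolding positive_lattice_def by blast
  then have zz: "int_vec (pos_part z) = z"
    by (intro nonneg_int_vec) (simp add: nonneg_part_def)
  then have "same_fiber A (pos_part z) 0"
    using z(1) by (simp add: same_fiber_iff_diff nonneg_part_def)
  then have "moves_connect M 0 (pos_part z)"
    using M same_fiber_sym markov_basis_connect unfolding smallest_markov_basis_def by metis
  moreover have "0 \<noteq> pos_part z"
    using zz z(2) by auto
  ultimately obtain y where "move_step M 0 y"
    by (metis converse_rtranclpE)
  then obtain v where v: "v \<in> M" "int_vec y = v \<or> int_vec y = - v"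
    unfolding move_step_def by auto
  have "v \<noteq> 0"
    using v(1) zero_notin_smallest_markov_basis[OF M] by blast
  with v(2) have "y \<noteq> 0" by auto
  moreover have "v = int_vec y \<or> v = - int_vec y"
    using v(2) by (metis minus_minus)
  ultimately show thesis
    using that v(1) by blast
qed

text \<open>The exchanged set still contains \<open>p\<close>, since \<open>v\<close> differs from
  \<open>p\<close>. The shifted move leads from \<open>neg_part v\<close> to
  \<open>pos_part v + k *s q\<close>, and \<open>k\<close> steps along \<open>p\<close> remove the
  surplus.\<close>

lemma shifted_move_in_universal_markov_basis:
  assumes M: "smallest_markov_basis A M" and p: "p \<in> M" "p = int_vec q \<or> p = - int_vec q"
    and v: "v \<in> M" "v \<noteq> p"
  shows "v + int k *s int_vec q \<in> universal_markov_basis A"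
proof -
  let ?v = "v + int k *s int_vec q" and ?M = "insert (v + int k *s int_vec q) (M - {v})"
  have sub: "M \<subseteq> kernel_lattice A"
    using M unfolding smallest_markov_basis_def markov_basis_def by blast
  have "int_vec q \<in> kernel_lattice A"
    using p sub kernel_neg[of "- int_vec q" A] by auto
  then have "?v \<in> kernel_lattice A"
    using v(1) sub by (intro kernel_add kernel_scale) auto
  moreover have "moves_connect ?M (neg_part v) (pos_part v)"
  proof -
    have "p \<in> ?M" using p v by blast
    then have "move_step ?M 0 q"
      using p(2) unfolding move_step_def by (intro bexI[of _ p]) auto
    then have "moves_connect ?M 0 (k *s q)"
      by (intro moves_connect_scale) blast
    then have "moves_connect ?M (0 + pos_part v) (k *s q + pos_part v)"
      by (rule moves_connect_add)
    then have "moves_connect ?M (k *s q + pos_part v) (pos_part v)"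
      using moves_connect_sym by simp
    moreover have "int_vec (k *s q + pos_part v) = int_vec (neg_part v) + ?v"
      using pos_part_minus_neg_part[of v] by (simp add: int_vec_scale algebra_simps)
    then have "move_step ?M (neg_part v) (k *s q + pos_part v)"
      unfolding move_step_def by blast
    ultimately show ?thesis
      by (rule converse_rtranclp_into_rtranclp[rotated])
  qed
  ultimately have "smallest_markov_basis A ?M"
    using smallest_markov_basis_replace[OF M v(1)] by blast
  then show ?thesis
    unfolding universal_markov_basis_eq up_to_sign_iff by blast
qed

text \<open>Since \<open>0\<close> is standard, \<open>q\<close> is nonstandard. If
  \<open>pos_part u\<close> leads, it is a corner above \<open>q\<close>, hence \<open>q\<close>
  itself, with tail \<open>0\<close>; if it is the tail, it must be standard although it lies above
  \<open>q\<close>.\<close>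

lemma dominating_not_in_universal_groebner_basis:
  fixes A :: "int ^ 'n ^ 'm"
  assumes q: "same_fiber A q 0" "q \<noteq> 0" "q \<le> pos_part u" and u: "u \<noteq> int_vec q"
  shows "u \<notin> universal_groebner_basis TYPE('k::field) A"
proof
  assume "u \<in> universal_groebner_basis TYPE('k) A"
  then obtain r where r: "term_order r"
    and pair: "groebner_pair A r (pos_part u) (neg_part u) \<or> groebner_pair A r (neg_part u) (pos_part u)"
    unfolding universal_groebner_basis_iff by blast
  interpret term_ord r using r by unfold_locales
  have std0: "standard A r 0"
    unfolding standard_def using le_imp by (simp add: less_eq_vec_def)
  then have q_ns: "\<not> standard A r q"
    using q standard_unique by blast
  from pair show False
  proof
    assume g: "groebner_pair A r (pos_part u) (neg_part u)"
    then have pos: "pos_part u = q"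
      using groebner_pair_corner(1)[OF g] q(3) q_ns unfolding corners_def by blast
    have "same_fiber A (pos_part u) (neg_part u)" "standard A r (neg_part u)"
      using g by (auto simp: groebner_pair_def)
    then have "neg_part u = 0"
      using pos q(1) std0 by (metis same_fiber_sym same_fiber_trans standard_unique)
    with pos have "u = int_vec q"
      using pos_part_minus_neg_part[of u] by simp
    with u show False ..
  next
    assume "groebner_pair A r (neg_part u) (pos_part u)"
    then have "standard A r (pos_part u)"
      by (simp add: groebner_pair_def)
    then show False
      using nonstandard_mono[OF q_ns q(3)] by blast
  qed
qed

lemma single_move_of_nonpositive:
  assumes sub: "universal_markov_basis A \<subseteq> universal_groebner_basis TYPE('k::field) A"
    and M: "smallest_markov_basis A M"
    and p: "p \<in> M" "q \<noteq> 0" "p = int_vec q \<or> p = - int_vec q"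
  shows "M = {p}"
proof (rule ccontr)
  assume "M \<noteq> {p}"
  then obtain v where v: "v \<in> M" "v \<noteq> p"
    using p(1) by blast
  \<comment> \<open>\<open>K\<close> exceeds every absolute value \<open>\<bar>v $ i\<bar>\<close>,
    so that \<open>v $ i + K * q $ i\<close> is at least \<open>q $ i\<close> wherever
    \<open>q $ i\<close> is positive.\<close>
  define K where "K = Suc (\<Sum>i\<in>UNIV. nat \<bar>v $ i\<bar>)"
  let ?u = "\<lambda>k. v + int k *s int_vec q"
  \<comment> \<open>Consecutive shifts differ by \<open>q\<close>, so they cannot both be the
    exceptional vector \<open>int_vec q\<close>.\<close>
  define k where "k = (if ?u K = int_vec q then Suc K else K)"
  have "?u (Suc K) = ?u K + int_vec q"
    by (simp add: vec_eq_iff algebra_simps)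
  moreover have "int_vec q \<noteq> 0"
    using p(2) by (metis int_vec_eq_iff int_vec_zero)
  ultimately have ne: "?u k \<noteq> int_vec q"
    by (simp add: k_def)
  have "q $ i \<le> pos_part (?u k) $ i" for i
  proof (cases "q $ i = 0")
    case False
    have "\<bar>v $ i\<bar> \<le> (\<Sum>i\<in>UNIV. \<bar>v $ i\<bar>)"
      by (rule member_le_sum) auto
    then have "1 + \<bar>v $ i\<bar> \<le> int K" "int K \<le> int k"
      by (simp_all add: K_def k_def)
    then have k: "1 + \<bar>v $ i\<bar> \<le> int k"
      by linarith
    have "\<bar>v $ i\<bar> * 1 \<le> \<bar>v $ i\<bar> * int (q $ i)"
      using False by (intro mult_left_mono) auto
    then have "int (q $ i) + \<bar>v $ i\<bar> \<le> (1 + \<bar>v $ i\<bar>) * int (q $ i)"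
      by (simp add: algebra_simps)
    also have "\<dots> \<le> int k * int (q $ i)"
      using k by (rule mult_right_mono) simp
    finally show ?thesis
      by simp
  qed simp
  then have "q \<le> pos_part (?u k)"
    by (simp add: less_eq_vec_def)
  moreover have "same_fiber A q 0"
  proof -
    have "p \<in> kernel_lattice A"
      using M p(1) unfolding smallest_markov_basis_def markov_basis_def by blast
    then show ?thesis
      using p(3) kernel_neg[of "- int_vec q" A] by (auto simp: same_fiber_iff_diff)
  qed
  ultimately have "?u k \<notin> universal_groebner_basis TYPE('k) A"
    using p(2) ne by (intro dominating_not_in_universal_groebner_basis)
  moreover have "?u k \<in> universal_markov_basis A"
    by (rule shifted_move_in_universal_markov_basis[OF M p(1,3) v])
  ultimately show False
    using sub by blast
qed

lemma markov_basis_span: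
  assumes "markov_basis A M"
  shows "int_module.span M = kernel_lattice A"
proof (rule int_module.span_subspace[OF _ _ kernel_subspace])
  show "M \<subseteq> kernel_lattice A"
    using assms by (simp add: markov_basis_def)
  show "kernel_lattice A \<subseteq> int_module.span M"
  proof
    fix u assume "u \<in> kernel_lattice A"
    then have "moves_connect M (neg_part u) (pos_part u)"
      using assms by (meson markov_basis_connect same_fiber_parts_iff same_fiber_sym)
    from moves_connect_span[OF this] show "u \<in> int_module.span M"
      by (simp add: pos_part_minus_neg_part)
  qed
qed

section \<open>Ranks of cyclic lattices\<close>

lemma independent_singleton:
  fixes p :: "int ^ 'n"
  assumes "p \<noteq> 0"
  shows "\<not> int_module.dependent {p}"
proof
  assume "int_module.dependent {p}"
  then obtain t u where t: "t \<subseteq> {p}" "(\<Sum>v\<in>t. u v *s v) = 0" "\<exists>v\<in>t. u v \<noteq> 0"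
    unfolding int_module.dependent_explicit by blast
  then have "t = {p}" by blast
  with t show False
    using assms by (auto simp: vec_eq_iff)
qed

text \<open>\<open>lattice_rank\<close> measures an arbitrarily chosen basis, so every basis has to
  be controlled. Distinct basis elements \<open>a *s p\<close> and \<open>b *s p\<close> would
  satisfy the nontrivial relation with coefficients \<open>b\<close> and \<open>- a\<close>.\<close>

lemma card_basis_of_cyclic:
  fixes p :: "int ^ 'n"
  assumes p: "p \<noteq> 0" and B: "\<not> int_module.dependent B" "int_module.span B = int_module.span {p}"
  shows "card B = 1"
proof -
  have "p \<in> int_module.span B"
    using B(2) int_module.span_base[of p "{p}"] by simp
  then have "B \<noteq> {}"
    using p by auto
  then obtain x where x: "x \<in> B" by blast
  have "y = x" if y: "y \<in> B" for y
  proof (rule ccontr)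
    assume "y \<noteq> x"
    have "x \<in> range (\<lambda>k. k *s p)" "y \<in> range (\<lambda>k. k *s p)"
      using x y B(2) int_module.span_base[of _ B] int_module.span_singleton[of p] by auto
    then obtain a b where ab: "x = a *s p" "y = b *s p"
      by blast
    have "0 \<notin> B"
      using B(1) int_module.dependent_zero by blast
    then have "b \<noteq> 0"
      using y ab by (metis vector_smult_lzero)
    have "int_module.dependent B"
      unfolding int_module.dependent_explicit
    proof (intro exI conjI)
      show "finite {x, y}" "{x, y} \<subseteq> B" using x y by auto
      have "(\<Sum>v\<in>{x, y}. (if v = x then b else - a) *s v) = b *s x + (- a) *s y"
        using \<open>y \<noteq> x\<close> by simp
      also have "\<dots> = 0"
        unfolding ab by (simp add: vec_eq_iff mult.left_commute)
      finally show "(\<Sum>v\<in>{x, y}. (if v = x then b else - a) *s v) = 0" .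
      show "\<exists>v\<in>{x, y}. (if v = x then b else - a) \<noteq> 0"
        using \<open>b \<noteq> 0\<close> by auto
    qed
    with B(1) show False ..
  qed
  then have "B = {x}" using x by blast
  then show ?thesis by simp
qed

lemma lattice_rank_cyclic:
  assumes "p \<noteq> 0"
  shows "lattice_rank (int_module.span {p}) = 1"
proof -
  have "\<exists>B. \<not> int_module.dependent B \<and> int_module.span B = int_module.span {p}"
    using independent_singleton[OF assms] by blast
  from someI_ex[OF this] show ?thesis
    unfolding lattice_rank_def using card_basis_of_cyclic[OF assms] by blast
qed

lemma pure_sublattice_subset:
  assumes "int_module.subspace L"
  shows "pure_sublattice L \<subseteq> L"
  unfolding pure_sublattice_def using assms
  by (intro int_module.span_minimal) (auto simp: nonneg_part_def)

lemma nonpositive_imp_cyclic: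
  assumes sub: "universal_markov_basis A \<subseteq> universal_groebner_basis TYPE('k::field) A"
    and L: "\<not> positive_lattice (kernel_lattice A)"
  shows "kernel_lattice A = pure_sublattice (kernel_lattice A) \<and> lattice_rank (kernel_lattice A) = 1"
proof -
  obtain M where M: "smallest_markov_basis A M"
    by (rule smallest_markov_basis_exists)
  obtain p q where p: "p \<in> M" "q \<noteq> 0" "p = int_vec q \<or> p = - int_vec q"
    using M L by (rule ex_nonneg_move)
  have "M = {p}"
    using sub M p by (rule single_move_of_nonpositive)
  then have span: "kernel_lattice A = int_module.span {p}"
    using M markov_basis_span unfolding smallest_markov_basis_def by blast
  have "p \<in> kernel_lattice A"
    unfolding span by (rule int_module.span_base) simp
  then have "int_vec q \<in> nonneg_part (kernel_lattice A)"
    using p(3) kernel_neg[of "- int_vec q" A] by (auto simp: nonneg_part_def)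
  then have "int_vec q \<in> pure_sublattice (kernel_lattice A)"
    unfolding pure_sublattice_def by (rule int_module.span_base)
  then have "p \<in> pure_sublattice (kernel_lattice A)"
    using p(3) int_module.span_neg unfolding pure_sublattice_def by blast
  then have "int_module.span {p} \<subseteq> pure_sublattice (kernel_lattice A)"
    unfolding pure_sublattice_def by (intro int_module.span_minimal) auto
  then have "kernel_lattice A = pure_sublattice (kernel_lattice A)"
    using span pure_sublattice_subset[OF kernel_subspace] by blast
  moreover have "p \<noteq> 0"
    using p(2,3) by (metis int_vec_eq_iff int_vec_zero neg_equal_0_iff_equal)
  ultimately show ?thesis
    using lattice_rank_cyclic span by metis
qed

section \<open>Cyclic lattices generated by a nonnegative vector\<close>

text \<open>Without a basis the choice in \<open>lattice_rank\<close> would say nothing about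
  \<open>L\<close>. A basis of the vectors vanishing at \<open>i\<close> is extended by a vector
  whose coordinate at \<open>i\<close> is the smallest positive one; Euclidean division by it
  reduces every vector of \<open>L\<close> to that sublattice.\<close>

lemma lattice_basis_exists_supported:
  fixes L :: "(int ^ 'n) set"
  assumes "finite T" "int_module.subspace L" "\<And>u i. u \<in> L \<Longrightarrow> i \<notin> T \<Longrightarrow> u $ i = 0"
  shows "\<exists>B. \<not> int_module.dependent B \<and> int_module.span B = L"
  using assms
proof (induction T arbitrary: L)
  case empty
  then have "L = {0}"
    using int_module.subspace_0[OF empty.prems(1)] by (auto simp: vec_eq_iff)
  then show ?case
    by (intro exI[of _ "{}"]) (simp add: int_module.dependent_explicit)
next
  case (insert i T)
  note sub = insert.prems(1)
  define L0 where "L0 = {u \<in> L. u $ i = 0}"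
  have sub0: "int_module.subspace L0"
    using sub unfolding int_module.subspace_def L0_def by auto
  have supp0: "u $ j = 0" if "u \<in> L0" "j \<notin> T" for u j
    using that insert.prems(2)[of u j] by (cases "j = i") (auto simp: L0_def)
  obtain B where B: "\<not> int_module.dependent B" "int_module.span B = L0"
    using insert.IH[OF sub0 supp0] by blast
  show ?case
  proof (cases "L0 = L")
    case True
    with B show ?thesis by blast
  next
    case False
    then obtain w where w: "w \<in> L" "w $ i \<noteq> 0"
      by (auto simp: L0_def)
    define P where "P = (\<lambda>v. v \<in> L \<and> 0 < v $ i)"
    have "P w \<or> P (- w)"
      unfolding P_def using w int_module.subspace_neg[OF sub] by auto
    then obtain v0 where "P v0" by blast
    define v where "v = (ARG_MIN (\<lambda>v. nat (v $ i)) v. P v)"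
    have v: "v \<in> L" "0 < v $ i"
      using arg_min_natI[of P v0 "\<lambda>v. nat (v $ i)", OF \<open>P v0\<close>] unfolding v_def P_def by simp_all
    have least: "v $ i \<le> u $ i" if "u \<in> L" "0 < u $ i" for u
      using arg_min_nat_le[of P u "\<lambda>v. nat (v $ i)"] that 
      unfolding v_def[symmetric] by (simp add: P_def)
    have red: "u - (u $ i div v $ i) *s v \<in> L0" if u: "u \<in> L" for u
    proof -
      let ?x = "u - (u $ i div v $ i) *s v"
      have "?x \<in> L"
        using u v(1) sub by (intro int_module.subspace_diff int_module.subspace_scale)
      moreover have "?x $ i = u $ i mod v $ i"
        by (simp add: minus_div_mult_eq_mod)
      moreover have "0 \<le> u $ i mod v $ i" "u $ i mod v $ i < v $ i"
        using v(2) by simp_all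
      \<comment> \<open>A positive remainder would be a smaller positive coordinate at
        \<open>i\<close> than that of \<open>v\<close>.\<close>
      ultimately show ?thesis
        using least[of ?x] unfolding L0_def by force
    qed
    have "int_module.span (insert v B) = L"
    proof (rule int_module.span_subspace[OF _ _ sub])
      show "insert v B \<subseteq> L"
        using v(1) B(2) int_module.span_superset[of B] unfolding L0_def by blast
      show "L \<subseteq> int_module.span (insert v B)"
        unfolding int_module.span_insert B(2) using red by blast
    qed
    moreover have "\<not> int_module.dependent (insert v B)"
    proof
      assume "int_module.dependent (insert v B)"
      then obtain t c where t: "finite t" "t \<subseteq> insert v B" "(\<Sum>x\<in>t. c x *s x) = 0" "\<exists>x\<in>t. c x \<noteq> 0"
        unfolding int_module.dependent_explicit by blast
      have Bi: "x $ i = 0" if "x \<in> B" for x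
        using that B(2) int_module.span_superset[of B] unfolding L0_def by blast
      \<comment> \<open>The elements of \<open>B\<close> vanish at \<open>i\<close>, so this
        coordinate isolates the coefficient of \<open>v\<close>.\<close>
      have "(\<Sum>x\<in>t. c x * x $ i) = 0"
        using arg_cong[OF t(3), of "\<lambda>y. y $ i"] by simp
      also have "(\<Sum>x\<in>t. c x * x $ i) = (\<Sum>x\<in>t. if x = v then c v * v $ i else 0)"
        using t(2) Bi by (intro sum.cong) auto
      finally have cv: "c v = 0" if "v \<in> t"
        using that v(2) t(1) by simp
      have "(\<Sum>x\<in>t - {v}. c x *s x) = (\<Sum>x\<in>t. c x *s x)"
        using t(1) cv by (intro sum.mono_neutral_left) auto
      then have "(\<Sum>x\<in>t - {v}. c x *s x) = 0"
        using t(3) by simp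
      moreover have "\<exists>x\<in>t - {v}. c x \<noteq> 0"
        using t(4) cv by auto
      moreover have "finite (t - {v})" "t - {v} \<subseteq> B"
        using t(1,2) by auto
      ultimately show False
        using B(1) unfolding int_module.dependent_explicit by blast
    qed
    ultimately show ?thesis by blast
  qed
qed

lemma lattice_basis_exists:
  fixes L :: "(int ^ 'n) set"
  assumes "int_module.subspace L"
  shows "\<exists>B. \<not> int_module.dependent B \<and> int_module.span B = L"
  by (rule lattice_basis_exists_supported[of UNIV]) (use assms in auto)

lemma lattice_rank_oneD:
  assumes "int_module.subspace L" "lattice_rank L = 1"
  obtains w where "w \<noteq> 0" "L = int_module.span {w}"
proof -
  let ?B = "SOME B. \<not> int_module.dependent B \<and> int_module.span B = L"
  have B: "\<not> int_module.dependent ?B \<and> int_module.span ?B = L"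
    using lattice_basis_exists[OF assms(1)] by (rule someI_ex)
  have "card ?B = 1"
    using assms(2) by (simp add: lattice_rank_def)
  then obtain w where w: "?B = {w}"
    by (rule card_1_singletonE)
  then have "w \<noteq> 0"
    using B int_module.dependent_zero by (metis insertI1)
  with B w that show thesis by metis
qed

text \<open>Purity yields a nonzero nonnegative vector, as otherwise the lattice would be zero. It
  is a multiple \<open>k *s w\<close> of a generator, so \<open>w\<close> or \<open>- w\<close>,
  according to the sign of \<open>k\<close>, is itself nonnegative.\<close>

lemma pure_rank_one_generator:
  assumes L: "int_module.subspace L" "L = pure_sublattice L" "lattice_rank L = 1"
  obtains q where "q \<noteq> 0" "L = int_module.span {int_vec q}"
proof -
  obtain w where w: "w \<noteq> 0" "L = int_module.span {w}"
    using L(1,3) by (rule lattice_rank_oneD)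
  then have wL: "w \<in> L"
    using int_module.span_base by blast
  have "\<not> nonneg_part L \<subseteq> {0}"
  proof
    assume "nonneg_part L \<subseteq> {0}"
    then have "pure_sublattice L \<subseteq> {0}"
      unfolding pure_sublattice_def by (rule int_module.span_minimal) simp
    then have "L \<subseteq> {0}"
      using L(2) by simp
    with wL w(1) show False by blast
  qed
  then obtain z where z: "z \<in> L" "\<And>i. 0 \<le> z $ i" "z \<noteq> 0"
    unfolding nonneg_part_def by blast
  then obtain k where k: "z = k *s w"
    using w(2) int_module.span_singleton[of w] by blast
  have "k \<noteq> 0"
    using k z(3) by auto
  define w' where "w' = (if 0 < k then w else - w)"
  have "0 \<le> w' $ i" for i
  proof -
    have "0 \<le> k * w $ i"
      using z(2)[of i] k by simp
    then show ?thesis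
      using \<open>k \<noteq> 0\<close> by (auto simp: w'_def zero_le_mult_iff)
  qed
  then have eq: "int_vec (pos_part w') = w'"
    by (rule nonneg_int_vec)
  have "int_module.span {w'} = L"
  proof (rule int_module.span_subspace[OF _ _ L(1)])
    show "{w'} \<subseteq> L"
      using wL int_module.subspace_neg[OF L(1)] by (auto simp: w'_def)
    have "w \<in> int_module.span {w'}"
      using int_module.span_base[of w' "{w'}"] int_module.span_neg[of w' "{w'}"]
      by (auto simp: w'_def split: if_splits)
    then show "L \<subseteq> int_module.span {w'}"
      unfolding w(2) by (intro int_module.span_minimal) auto
  qed
  moreover have "pos_part w' \<noteq> 0"
    using eq w(1) by (auto simp: w'_def)
  ultimately show thesis
    using that[of "pos_part w'"] eq by simp
qed

lemma cyclic_imp_markov_subset_groebner: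
  fixes A :: "int ^ 'n ^ 'm"
  assumes L: "kernel_lattice A = pure_sublattice (kernel_lattice A)"
    and rank: "lattice_rank (kernel_lattice A) = 1"
  shows "universal_markov_basis A \<subseteq> universal_groebner_basis TYPE('k::field) A"
proof -
  obtain q where q: "q \<noteq> 0" and span: "kernel_lattice A = int_module.span {int_vec q}"
    using kernel_subspace L rank by (rule pure_rank_one_generator)
  let ?p = "int_vec q"
  have p: "?p \<noteq> 0"
    using q by (metis int_vec_eq_iff int_vec_zero)
  have mem: "u \<in> kernel_lattice A \<longleftrightarrow> (\<exists>k. u = k *s ?p)" for u
    unfolding span int_module.span_singleton by blast
  then have pL: "?p \<in> kernel_lattice A"
    using span int_module.span_base by blast
  obtain M\<^sub>0 where M0: "markov_basis A M\<^sub>0"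
    by (rule markov_basis_exists)
  \<comment> \<open>Simulating an arbitrary Markov basis suffices: its moves are multiples of
    \<open>q\<close>, and such a move joins \<open>0\<close> to a natural multiple of
    \<open>q\<close>.\<close>
  have basis: "markov_basis A {?p}"
  proof (rule markov_basis_simulate[OF M0])
    fix v assume "v \<in> M\<^sub>0"
    then obtain k where k: "v = k *s ?p"
      using M0 mem unfolding markov_basis_def by blast
    have "move_step {?p} 0 q"
      by (simp add: move_step_def)
    then have conn: "moves_connect {?p} 0 (nat j *s q)" for j
      by (intro moves_connect_scale) blast
    show "moves_connect {?p} (neg_part v) (pos_part v)"
    proof (cases "0 \<le> k")
      case True
      then have "neg_part v = 0" "pos_part v = nat k *s q"
        by (simp_all add: k vec_eq_iff nat_mult_distrib)
      with conn show ?thesis by metis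
    next
      case False
      then have "nat (k * int x) = 0" "nat (- (k * int x)) = nat (- k) * x" for x
        using nat_mult_distrib[of "- k" "int x"] by (simp_all add: mult_nonpos_nonneg)
      then have "pos_part v = 0" "neg_part v = nat (- k) *s q"
        by (simp_all add: k vec_eq_iff)
      with conn show ?thesis by (metis moves_connect_sym)
    qed
  qed (use pL in auto)
  \<comment> \<open>A smallest basis has at most one element, which must generate the same cyclic
    group as \<open>q\<close>; two generators differ by a unit of the integers.\<close>
  have gens: "m = ?p \<or> m = - ?p" if M: "smallest_markov_basis A M" "m \<in> M" for M m
  proof -
    have "card M \<le> 1"
      using M(1) basis unfolding smallest_markov_basis_def by force
    moreover have "finite M"
      using M(1) unfolding smallest_markov_basis_def markov_basis_def by blast
    ultimately have "M = {m}"
      using M(2) by (metis card_1_singletonE card_gt_0_iff empty_iff le_antisym less_eq_Suc_le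
          One_nat_def singletonD)
    then have "kernel_lattice A = int_module.span {m}"
      using M(1) markov_basis_span unfolding smallest_markov_basis_def by blast
    then obtain j where j: "?p = j *s m"
      using pL int_module.span_singleton[of m] by blast
    have "m \<in> kernel_lattice A"
      using M \<open>M = {m}\<close> unfolding smallest_markov_basis_def markov_basis_def by blast
    then obtain k where k: "m = k *s ?p"
      using mem by blast
    obtain i where i: "?p $ i \<noteq> 0"
      using p by (auto simp: vec_eq_iff)
    have "?p $ i = j * (k * ?p $ i)"
      using j k by (metis vector_smult_component)
    then have "j * k = 1"
      using i by (metis mult.assoc mult_cancel_right1)
    then have "k = 1 \<or> k = - 1"
      by (metis mult.commute zmult_eq_1_iff)
    then show ?thesis
      using k by (auto simp: vec_eq_iff)
  qed
  obtain r :: "(nat ^ 'n) rel" where r: "term_order r"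
    by (rule term_order_exists)
  interpret term_ord r using r by unfold_locales
  \<comment> \<open>Any term order will do: an element of this fiber that shares a variable with
    \<open>q\<close> is a positive multiple of \<open>q\<close>, hence above it
    componentwise.\<close>
  have "(q, t) \<in> r" if t: "same_fiber A q t" "\<not> disjoint_support q t" for t
  proof -
    have "int_vec t - ?p \<in> kernel_lattice A"
      using t(1) same_fiber_sym same_fiber_iff_diff by blast
    then obtain k where "int_vec t - ?p = k *s ?p"
      using mem by blast
    then have *: "int (t $ j) = (k + 1) * int (q $ j)" for j
      by (simp add: vec_eq_iff algebra_simps)
    obtain i where "q $ i \<noteq> 0" "t $ i \<noteq> 0"
      using t(2) unfolding disjoint_support_def by blast
    then have "0 < (k + 1) * int (q $ i)"
      using *[of i] by simp
    then have "1 \<le> k + 1"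
      by (simp add: zero_less_mult_iff)
    then have "1 * int (q $ j) \<le> int (t $ j)" for j
      unfolding * by (rule mult_right_mono) simp
    then have "q \<le> t"
      by (simp add: less_eq_vec_def)
    then show ?thesis by (rule le_imp)
  qed
  moreover have "same_fiber A q 0"
    using pL by (simp add: same_fiber_iff_diff)
  moreover have "standard A r 0"
    unfolding standard_def using le_imp by (simp add: less_eq_vec_def)
  ultimately have "groebner_pair A r q 0"
    using q by (simp add: groebner_pair_def)
  moreover have "pos_part ?p = q" "neg_part ?p = 0"
    by (simp_all add: vec_eq_iff)
  ultimately have pG: "?p \<in> universal_groebner_basis TYPE('k) A" "- ?p \<in> universal_groebner_basis TYPE('k) A"
    unfolding universal_groebner_basis_iff pos_part_uminus neg_part_uminus using r by auto
  show ?thesis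
  proof
    fix u assume "u \<in> universal_markov_basis A"
    then have "u = ?p \<or> u = - ?p"
      unfolding universal_markov_basis_eq up_to_sign_iff using gens
      by (metis (no_types, lifting) Union_iff mem_Collect_eq minus_minus)
    with pG show "u \<in> universal_groebner_basis TYPE('k) A" by blast
  qed
qed

section \<open>Convexity and integer relations\<close>

text \<open>Coefficients belong to indices instead of points, since the points may coincide, as
  equal columns of a matrix do.\<close>

lemma convex_hull_image_coeffs:
  fixes c :: "'a \<Rightarrow> 'b::real_vector"
  assumes "finite I" "y \<in> convex hull (c ` I)"
  shows "\<exists>l. (\<forall>i\<in>I. 0 \<le> l i) \<and> sum l I = 1 \<and> y = (\<Sum>i\<in>I. l i *\<^sub>R c i)"
proof -
  let ?T = "{y. \<exists>l. (\<forall>i\<in>I. 0 \<le> l i) \<and> sum l I = 1 \<and> y = (\<Sum>i\<in>I. l i *\<^sub>R c i)}"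
  have "c ` I \<subseteq> ?T"
  proof
    fix x assume "x \<in> c ` I"
    then obtain j where j: "j \<in> I" "x = c j" by blast
    have "(\<Sum>i\<in>I. (if i = j then 1 else 0) *\<^sub>R c i) = (\<Sum>i\<in>I. if i = j then c i else 0)"
      by (intro sum.cong) auto
    also have "\<dots> = x"
      using j assms(1) by simp
    finally show "x \<in> ?T"
      using j assms(1) by (intro CollectI exI[of _ "\<lambda>i. if i = j then 1 else 0"]) simp
  qed
  moreover have "convex ?T"
  proof (rule convexI)
    fix x y and u v :: real
    assume "x \<in> ?T" "y \<in> ?T" and uv: "0 \<le> u" "0 \<le> v" "u + v = 1"
    then obtain l k where l: "\<forall>i\<in>I. 0 \<le> l i" "sum l I = 1" "x = (\<Sum>i\<in>I. l i *\<^sub>R c i)"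
      and k: "\<forall>i\<in>I. 0 \<le> k i" "sum k I = 1" "y = (\<Sum>i\<in>I. k i *\<^sub>R c i)" by blast
    have "u *\<^sub>R x + v *\<^sub>R y = (\<Sum>i\<in>I. (u * l i + v * k i) *\<^sub>R c i)"
      by (simp add: l(3) k(3) scaleR_sum_right sum.distrib scaleR_left_distrib)
    moreover have "(\<Sum>i\<in>I. u * l i + v * k i) = 1"
      by (simp add: sum.distrib l(2) k(2) uv(3) flip: sum_distrib_left)
    moreover have "\<forall>i\<in>I. 0 \<le> u * l i + v * k i"
      using l(1) k(1) uv by simp
    ultimately show "u *\<^sub>R x + v *\<^sub>R y \<in> ?T"
      by (intro CollectI exI[of _ "\<lambda>i. u * l i + v * k i"] conjI)
  qed
  ultimately have "convex hull (c ` I) \<subseteq> ?T"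
    by (rule hull_minimal)
  with assms(2) have "y \<in> ?T" by (rule rev_subsetD)
  then show ?thesis
    by (rule CollectD)
qed

text \<open>A real relation with nonnegative coefficients among integer vectors becomes, after simultaneous
  Dirichlet approximation of a multiple of the coefficients, a relation that holds up to an error
  smaller than one, hence exactly.\<close>

lemma nonneg_integer_relation:
  fixes z :: "'a \<Rightarrow> int ^ 'm" and l :: "'a \<Rightarrow> real"
  assumes S: "finite S" and l: "\<forall>s\<in>S. 0 \<le> l s"
    and rel: "\<forall>i. (\<Sum>s\<in>S. l s * real_of_int (z s $ i)) = 0"
    and s0: "s\<^sub>0 \<in> S" "0 < l s\<^sub>0"
  shows "\<exists>p :: 'a \<Rightarrow> nat. (\<forall>i. (\<Sum>s\<in>S. int (p s) * z s $ i) = 0) \<and> p s\<^sub>0 \<noteq> 0 \<and>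
    (\<forall>s\<in>S. l s = 0 \<longrightarrow> p s = 0)"
proof -
  obtain e :: "'a \<Rightarrow> nat" and n where e: "e ` S = {i. i < n}" "inj_on e S"
    using finite_imp_inj_to_nat_seg[OF S] by blast
  obtain N1 :: nat where N1: "1 / l s\<^sub>0 < real N1"
    using reals_Archimedean2 by blast
  \<comment> \<open>The summand \<open>N1\<close> makes \<open>1 / N\<close> at most
    \<open>l s\<^sub>0\<close>, so the approximation of that coefficient stays positive. The other
    summand exceeds each sum of the absolute values \<open>\<bar>z s $ i\<bar>\<close> over
    \<open>S\<close>, so the total error in every coordinate is below 1.\<close>
  define N where "N = N1 + Suc (nat (\<Sum>s\<in>S. \<Sum>i\<in>UNIV. \<bar>z s $ i\<bar>))"
  have "0 < N" by (simp add: N_def)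
  obtain q p' where q: "(0::int) < q" and
    approx: "\<And>i. i < n \<Longrightarrow> \<bar>of_int q * l (inv_into S e i) - of_int (p' i)\<bar> < 1 / real N"
    using Dirichlet_approx_simult[OF \<open>0 < N\<close>, of n "\<lambda>i. l (inv_into S e i)"] by metis
  define P where "P = (\<lambda>s. p' (e s))"
  have P: "\<bar>of_int q * l s - of_int (P s)\<bar> < 1 / real N" if "s \<in> S" for s
    using approx[of "e s"] that e unfolding P_def by auto
  have N_le: "1 / real N \<le> 1"
    using \<open>0 < N\<close> by simp
  have P_nonneg: "0 \<le> P s" if "s \<in> S" for s
  proof -
    have "0 \<le> of_int q * l s"
      using q l that by simp
    then have "- 1 < real_of_int (P s)"
      using P[OF that] N_le by linarith
    then show ?thesis by linarith
  qed
  have sum_le: "(\<Sum>s\<in>S. \<bar>z s $ i\<bar>) < int N" for i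
  proof -
    have "(\<Sum>s\<in>S. \<bar>z s $ i\<bar>) \<le> (\<Sum>s\<in>S. \<Sum>i\<in>UNIV. \<bar>z s $ i\<bar>)"
      by (intro sum_mono member_le_sum) auto
    then show ?thesis by (simp add: N_def)
  qed
  have zero: "(\<Sum>s\<in>S. P s * z s $ i) = 0" for i
  proof -
    have "real_of_int (\<Sum>s\<in>S. P s * z s $ i) =
        (\<Sum>s\<in>S. of_int (P s) * of_int (z s $ i)) - of_int q * (\<Sum>s\<in>S. l s * of_int (z s $ i))"
      by (simp add: rel)
    also have "\<dots> = (\<Sum>s\<in>S. (of_int (P s) - of_int q * l s) * of_int (z s $ i))"
      by (simp only: sum_distrib_left left_diff_distrib sum_subtractf mult.assoc)
    also have "\<bar>\<dots>\<bar> \<le> (\<Sum>s\<in>S. \<bar>(of_int (P s) - of_int q * l s) * of_int (z s $ i)\<bar>)"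
      by (rule sum_abs)
    also have "\<dots> \<le> (\<Sum>s\<in>S. 1 / real N * of_int \<bar>z s $ i\<bar>)"
    proof (rule sum_mono)
      fix s assume "s \<in> S"
      then have "\<bar>of_int (P s) - of_int q * l s\<bar> \<le> 1 / real N"
        using P[of s] by linarith
      then show "\<bar>(of_int (P s) - of_int q * l s) * of_int (z s $ i)\<bar> \<le> 1 / real N * of_int \<bar>z s $ i\<bar>"
        unfolding abs_mult of_int_abs by (rule mult_right_mono) simp
    qed
    also have "\<dots> = of_int (\<Sum>s\<in>S. \<bar>z s $ i\<bar>) / real N"
      by (simp add: sum_divide_distrib)
    also have "\<dots> < 1"
      using sum_le[of i] \<open>0 < N\<close> by (simp add: divide_less_eq del: of_int_sum)
    finally show ?thesis by linarith
  qed
  show ?thesis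
  proof (intro exI[of _ "\<lambda>s. nat (P s)"] conjI allI ballI impI)
    show "(\<Sum>s\<in>S. int (nat (P s)) * z s $ i) = 0" for i
      using zero[of i] P_nonneg by (simp cong: sum.cong)
    have "1 / real N \<le> l s\<^sub>0"
    proof -
      have "1 < l s\<^sub>0 * real N1"
        using N1 s0(2) by (simp add: divide_less_eq mult.commute)
      also have "\<dots> \<le> l s\<^sub>0 * real N"
        using s0(2) by (intro mult_left_mono) (simp_all add: N_def)
      finally show ?thesis
        using \<open>0 < N\<close> by (simp add: divide_le_eq)
    qed
    also have "\<dots> \<le> of_int q * l s\<^sub>0"
      using q s0(2) by simp
    finally have "0 < real_of_int (P s\<^sub>0)"
      using P[OF s0(1)] by linarith
    then show "nat (P s\<^sub>0) \<noteq> 0" by simp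
    show "nat (P s) = 0" if "s \<in> S" "l s = 0" for s
    proof -
      have "\<bar>real_of_int (P s)\<bar> < 1"
        using P[OF that(1)] that(2) N_le by simp
      then show ?thesis by linarith
    qed
  qed
qed

text \<open>A theorem of the alternative for the columns of \<open>A\<close>. If \<open>0\<close> is
  a convex combination of them, the integral form of this relation is a nonzero nonnegative vector
  of the lattice; otherwise a hyperplane separates \<open>0\<close> strictly from all
  columns.\<close>

lemma positive_grading_exists:
  fixes A :: "int ^ 'n ^ 'm"
  assumes "positive_lattice (kernel_lattice A)"
  obtains d :: "real ^ 'n" where "\<forall>j. 0 < d $ j"
    "\<forall>a b. same_fiber A a b \<longrightarrow> d \<bullet> real_vec a = d \<bullet> real_vec b"
proof -
  define c :: "'n \<Rightarrow> real ^ 'm" where "c = (\<lambda>j. \<chi> i. real_of_int (A $ i $ j))"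
  have "0 \<notin> convex hull (range c)"
  proof
    assume "0 \<in> convex hull (range c)"
    from convex_hull_image_coeffs[OF finite_class.finite_UNIV this]
    obtain l where l: "\<forall>j\<in>UNIV. 0 \<le> l j" "sum l UNIV = 1" "0 = (\<Sum>j\<in>UNIV. l j *\<^sub>R c j)"
      by (elim exE conjE)
    have "sum l UNIV \<noteq> 0"
      using l(2) by simp
    then obtain j0 where "l j0 \<noteq> 0"
      by (rule sum.not_neutral_contains_not_neutral)
    then have j0: "0 < l j0"
      using l(1) by (simp add: less_le)
    define z :: "'n \<Rightarrow> int ^ 'm" where "z = (\<lambda>j. \<chi> i. A $ i $ j)"
    have "(\<Sum>j\<in>UNIV. l j * real_of_int (z j $ i)) = 0" for i
      using arg_cong[OF l(3), of "\<lambda>x. x $ i"] by (simp add: c_def z_def)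
    then have "\<forall>i. (\<Sum>j\<in>UNIV. l j * real_of_int (z j $ i)) = 0"
      by (rule allI)
    from nonneg_integer_relation[OF finite_class.finite_UNIV l(1) this UNIV_I j0]
    obtain p :: "'n \<Rightarrow> nat" where p: "\<forall>i. (\<Sum>j\<in>UNIV. int (p j) * z j $ i) = 0" "p j0 \<noteq> 0"
      by (elim exE conjE)
    define x where "x = (\<chi> j. int (p j))"
    have "A *v x = 0"
      using p(1) by (simp add: vec_eq_iff matrix_vector_mult_def x_def z_def mult.commute)
    then have "x \<in> nonneg_part (kernel_lattice A)"
      by (simp add: nonneg_part_def kernel_lattice_def x_def)
    moreover have "x \<noteq> 0"
      using p(2) by (auto simp: x_def vec_eq_iff)
    ultimately show False
      using assms unfolding positive_lattice_def by blast
  qed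
  moreover have "closed (convex hull (range c))"
    by (intro compact_imp_closed finite_imp_compact_convex_hull) simp
  ultimately obtain y b where y: "0 < b" "\<forall>x\<in>convex hull (range c). b < y \<bullet> x"
    using separating_hyperplane_closed_0[of "convex hull (range c)"] convex_convex_hull by metis
  \<comment> \<open>A real combination of the rows of \<open>A\<close>, hence constant on fibers;
    the separation makes its entries positive.\<close>
  define d where "d = (\<chi> j. y \<bullet> c j)"
  show thesis
  proof (rule that[of d]; intro allI impI)
    show "0 < d $ j" for j
      using y hull_inc[of "c j" "range c" convex] by (force simp: d_def)
    have deg: "d \<bullet> real_vec a = (\<Sum>i\<in>UNIV. y $ i * real_of_int ((A *v int_vec a) $ i))" for a
    proof -
      have "d \<bullet> real_vec a = (\<Sum>j\<in>UNIV. \<Sum>i\<in>UNIV. y $ i * real_of_int (A $ i $ j) * real (a $ j))"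
        by (simp add: inner_real_vec d_def inner_vec_def c_def sum_distrib_right)
      also have "\<dots> = (\<Sum>i\<in>UNIV. \<Sum>j\<in>UNIV. y $ i * real_of_int (A $ i $ j) * real (a $ j))"
        by (rule sum.swap)
      also have "\<dots> = (\<Sum>i\<in>UNIV. y $ i * real_of_int ((A *v int_vec a) $ i))"
      proof (rule sum.cong[OF refl])
        fix i
        have "real_of_int ((A *v int_vec a) $ i) = (\<Sum>j\<in>UNIV. real_of_int (A $ i $ j) * real (a $ j))"
          by (simp add: matrix_vector_mult_def)
        then show "(\<Sum>j\<in>UNIV. y $ i * real_of_int (A $ i $ j) * real (a $ j)) =
            y $ i * real_of_int ((A *v int_vec a) $ i)"
          by (simp only: sum_distrib_left mult.assoc)
      qed
      finally show ?thesis .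
    qed
    show "d \<bullet> real_vec a = d \<bullet> real_vec b" if "same_fiber A a b" for a b
      using that unfolding deg same_fiber_def by simp
  qed
qed

text \<open>A hull stays convex when an extreme point is removed, so this point is outside the
  compact hull of the remaining points and can be separated from it.\<close>

lemma extreme_point_weight:
  assumes C: "finite C" and t: "real_vec t extreme_point_of (convex hull (real_vec ` C))"
  obtains c where "\<And>w. w \<in> C \<Longrightarrow> w \<noteq> t \<Longrightarrow> c \<bullet> real_vec t < c \<bullet> real_vec w"
proof -
  let ?H = "convex hull (real_vec ` C)" and ?K = "convex hull (real_vec ` (C - {t}))"
  have "convex (?H - {real_vec t})"
    using t extreme_point_of_stillconvex[of ?H] by simp
  moreover have "real_vec ` (C - {t}) \<subseteq> ?H - {real_vec t}"
    using hull_subset[of "real_vec ` C" convex] by auto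
  ultimately have "?K \<subseteq> ?H - {real_vec t}"
    by (intro hull_minimal)
  then have "real_vec t \<notin> ?K" by blast
  moreover have "closed ?K"
    using C by (intro compact_imp_closed finite_imp_compact_convex_hull) simp
  ultimately obtain c b where cb: "c \<bullet> real_vec t < b" "\<forall>x\<in>?K. b < c \<bullet> x"
    using separating_hyperplane_closed_point[of ?K "real_vec t"] convex_convex_hull by metis
  show thesis
  proof (rule that[of c])
    fix w assume "w \<in> C" "w \<noteq> t"
    then have "real_vec w \<in> ?K"
      by (intro hull_inc) simp
    with cb show "c \<bullet> real_vec t < c \<bullet> real_vec w"
      by force
  qed
qed

section \<open>Connected components of fibers\<close>

text \<open>The edges of all fiber graphs at once; since edges stay within a fiber, its closure
  gives the components without naming the fiber.\<close>

definition adjacent :: "int ^ 'n ^ 'm \<Rightarrow> nat ^ 'n \<Rightarrow> nat ^ 'n \<Rightarrow> bool"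
  where "adjacent A a b \<longleftrightarrow> same_fiber A a b \<and> \<not> disjoint_support a b"

abbreviation linked :: "int ^ 'n ^ 'm \<Rightarrow> nat ^ 'n \<Rightarrow> nat ^ 'n \<Rightarrow> bool"
  where "linked A \<equiv> (adjacent A)\<^sup>*\<^sup>*"

lemma adjacentI: "same_fiber A a b \<Longrightarrow> a $ i \<noteq> 0 \<Longrightarrow> b $ i \<noteq> 0 \<Longrightarrow> adjacent A a b"
  unfolding adjacent_def disjoint_support_def by metis

lemma adjacent_sym: "adjacent A a b \<Longrightarrow> adjacent A b a"
  unfolding adjacent_def using same_fiber_sym disjoint_support_sym by metis

lemma linked_sym: "linked A a b \<Longrightarrow> linked A b a"
  by (metis adjacent_sym symp_rtranclp symp_def)

lemma linked_same_fiber: "linked A a b \<Longrightarrow> same_fiber A a b"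
  by (induction rule: rtranclp_induct) (auto simp: adjacent_def intro: same_fiber_trans)

lemma disjoint_support_of_not_linked:
  assumes "same_fiber A a b" "\<not> linked A a b"
  shows "disjoint_support a b"
proof (rule ccontr)
  assume "\<not> disjoint_support a b"
  with assms(1) have "adjacent A a b"
    by (simp add: adjacent_def)
  with assms(2) show False by blast
qed

lemma linked_iff_fiber_graph:
  assumes x: "x \<in> fiber (kernel_lattice A) u"
  shows "(x, y) \<in> (fiber_graph (fiber (kernel_lattice A) u))\<^sup>* \<longleftrightarrow> linked A x y"
proof
  have edge: "(a, b) \<in> fiber_graph (fiber (kernel_lattice A) u) \<longleftrightarrow> adjacent A a b"
    if "same_fiber A x a" for a b
  proof -
    have a: "same_fiber A (pos_part u) a"
      using x that unfolding mem_fiber_iff by (rule same_fiber_trans)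
    then have "same_fiber A (pos_part u) b \<longleftrightarrow> same_fiber A a b"
      by (meson same_fiber_sym same_fiber_trans)
    with a show ?thesis
      by (auto simp: fiber_graph_def mem_fiber_iff adjacent_def disjoint_support_def)
  qed
  show "linked A x y" if "(x, y) \<in> (fiber_graph (fiber (kernel_lattice A) u))\<^sup>*"
    using that
  proof (induction rule: rtrancl_induct)
    case (step y z)
    then show ?case
      using edge linked_same_fiber by (metis rtranclp.rtrancl_into_rtrancl)
  qed simp
  show "(x, y) \<in> (fiber_graph (fiber (kernel_lattice A) u))\<^sup>*" if "linked A x y"
    using that
  proof (induction rule: rtranclp_induct)
    case (step y z)
    then show ?case
      using edge linked_same_fiber by (metis rtrancl.rtrancl_into_rtrancl)
  qed simp
qed

lemma graph_components_fiber:
  "graph_components (fiber (kernel_lattice A) u) =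
    {{w. linked A t w} | t. t \<in> fiber (kernel_lattice A) u}"
proof -
  have "(fiber_graph (fiber (kernel_lattice A) u))\<^sup>* `` {t} = {w. linked A t w}"
    if "t \<in> fiber (kernel_lattice A) u" for t
    using linked_iff_fiber_graph[OF that] by auto
  then show ?thesis
    unfolding graph_components_def quotient_def by auto
qed

text \<open>Extreme points of a hull belong to the generating set, so \<open>P\<close> is the hull
  of the component that contains \<open>t\<close>.\<close>

lemma extreme_point_of_component:
  assumes P: "P \<in> markov_polyhedra (kernel_lattice A) u" and t: "real_vec t extreme_point_of P"
  shows "real_vec t extreme_point_of (convex hull (real_vec ` {w. linked A t w}))"
proof -
  obtain x where P: "P = convex hull (real_vec ` {w. linked A x w})"
    using P unfolding markov_polyhedra_def graph_components_fiber by blast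
  then have "real_vec t \<in> real_vec ` {w. linked A x w}"
    using t extreme_point_of_convex_hull by blast
  then have "linked A x t" by auto
  then have "{w. linked A x w} = {w. linked A t w}"
    by (metis linked_sym rtranclp_trans)
  with P t show ?thesis by simp
qed

lemma move_step_remove:
  assumes "move_step M a b"
  shows "move_step (M - {v}) a b \<or> (\<exists>s. {a, b} = {pos_part v + s, neg_part v + s})"
proof -
  obtain w where w: "w \<in> M" "int_vec b = int_vec a + w \<or> int_vec b = int_vec a - w"
    using assms unfolding move_step_def by blast
  show ?thesis
  proof (cases "w = v")
    case True
    then have "move_step {v} a b"
      using w(2) by (simp add: move_step_def)
    then show ?thesis
      by (elim move_step_cases) auto
  next
    case False
    with w show ?thesis unfolding move_step_def by blast
  qed
qed

section \<open>Positive lattices\<close>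

text \<open>Positivity of the lattice enters the following arguments only through this weight, by
  comparing degrees.\<close>

locale graded =
  fixes A :: "int ^ 'n ^ 'm" and d :: "real ^ 'n"
  assumes pos: "\<And>j. 0 < d $ j"
    and const: "\<And>a b. same_fiber A a b \<Longrightarrow> d \<bullet> real_vec a = d \<bullet> real_vec b"
begin

lemma degree_nonneg: "0 \<le> d \<bullet> real_vec a"
  unfolding inner_real_vec using pos by (intro sum_nonneg) (simp add: less_imp_le)

lemma degree_eq_0_iff [simp]: "d \<bullet> real_vec a = 0 \<longleftrightarrow> a = 0"
proof
  assume "d \<bullet> real_vec a = 0"
  then have "\<forall>i\<in>UNIV. d $ i * real (a $ i) = 0"
    unfolding inner_real_vec using pos
    by (subst (asm) sum_nonneg_eq_0_iff) (simp_all add: less_imp_le)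
  then show "a = 0"
    using pos by (simp add: vec_eq_iff) (metis less_irrefl)
qed simp

lemma same_fiber_add_eq_0: "same_fiber A a (a + s) \<Longrightarrow> s = 0"
  using const[of a "a + s"] by (simp add: inner_add_right)

text \<open>Elements of equal positive degree are incomparable, so the fiber is an
  antichain.\<close>

lemma finite_same_fiber: "finite {t. same_fiber A a t}"
proof (rule finite_antichain)
  fix x y assume "x \<in> {t. same_fiber A a t}" "y \<in> {t. same_fiber A a t}" "x \<le> y"
  then have "same_fiber A x y"
    by (metis mem_Collect_eq same_fiber_sym same_fiber_trans)
  moreover obtain s where "y = x + s"
    using \<open>x \<le> y\<close> nat_vec_le_iff by blast
  ultimately show "x = y"
    using same_fiber_add_eq_0 by simp
qed

lemma finite_component: "finite {w. linked A t w}"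
  using finite_subset[OF _ finite_same_fiber[of t]] linked_same_fiber by blast

text \<open>Two exponents sharing a variable are translates of a pair of smaller degree, so the moves
  connecting them have smaller degree as well.\<close>

lemma adjacent_connect_remove:
  assumes M: "markov_basis A M" and a: "same_fiber A (pos_part v) a" and v: "v \<in> kernel_lattice A"
    and ab: "adjacent A a b"
  shows "moves_connect (M - {v}) a b"
proof -
  obtain i where "a $ i \<noteq> 0" "b $ i \<noteq> 0"
    using ab unfolding adjacent_def disjoint_support_def by blast
  then obtain a' b' where a': "a = a' + axis i 1" "b = b' + axis i 1"
    by (metis nat_vec_unit_add)
  have "same_fiber A a' b'"
    using ab a' by (simp add: adjacent_def)
  then have "moves_connect M a' b'"
    using M markov_basis_connect by blast
  then have "moves_connect (M - {v}) a' b'"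
  proof (induction rule: rtranclp_induct)
    case (step y z)
    \<comment> \<open>All points of the path have the degree of \<open>a'\<close>, which is below
      that of \<open>a\<close> by the degree of one variable; a translate of an end of
      \<open>v\<close> has at least the degree of \<open>a\<close>.\<close>
    have "\<not> {y, z} = {pos_part v + s, neg_part v + s}" for s
    proof
      assume "{y, z} = {pos_part v + s, neg_part v + s}"
      then have "y = pos_part v + s \<or> y = neg_part v + s" by blast
      then have "d \<bullet> real_vec y = d \<bullet> real_vec (pos_part v) + d \<bullet> real_vec s"
        using v const[of "pos_part v" "neg_part v"] same_fiber_parts_iff[of A v]
        by (auto simp: inner_add_right)
      also have "d \<bullet> real_vec (pos_part v) = d \<bullet> real_vec a"
        using a by (rule const)
      also have "\<dots> = d \<bullet> real_vec a' + d \<bullet> real_vec (axis i 1)"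
        using a' by (simp add: inner_add_right)
      also have "d \<bullet> real_vec a' = d \<bullet> real_vec y"
        using step.hyps(1) M by (meson const markov_basis_def moves_connect_same_fiber)
      finally have "d \<bullet> real_vec (axis i 1) + d \<bullet> real_vec s = 0"
        by simp
      then have "d \<bullet> real_vec (axis i 1) = 0"
        using degree_nonneg[of s] degree_nonneg[of "axis i 1"] by linarith
      then have "axis i (1::nat) = 0"
        by simp
      then show False
        by (metis axis_eq_0_iff zero_neq_one)
    qed
    then have "move_step (M - {v}) y z"
      using move_step_remove[OF step.hyps(2), of v] by blast
    with step.IH show ?case by (rule rtranclp.rtrancl_into_rtrancl)
  qed simp
  then show ?thesis
    unfolding a' by (rule moves_connect_add)
qed

text \<open>Each edge of a path between the two parts could be replaced by moves other than
  \<open>v\<close>, which would make \<open>v\<close> redundant.\<close>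

lemma minimal_markov_basis_not_linked:
  assumes M: "minimal_markov_basis A M" "v \<in> M"
  shows "\<not> linked A (pos_part v) (neg_part v)"
proof
  assume linked: "linked A (pos_part v) (neg_part v)"
  have basis: "markov_basis A M"
    using M(1) by (simp add: minimal_markov_basis_def)
  then have v: "v \<in> kernel_lattice A"
    using M(2) unfolding markov_basis_def by blast
  have "moves_connect (M - {v}) (pos_part v) (neg_part v)"
    using linked
  proof (induction rule: rtranclp_induct)
    case (step y z)
    have "moves_connect (M - {v}) y z"
      using adjacent_connect_remove[OF basis linked_same_fiber[OF step.hyps(1)] v step.hyps(2)] .
    with step.IH show ?case by (rule rtranclp_trans)
  qed simp
  then show False
    using minimal_markov_basis_removal[OF M] moves_connect_sym by blast
qed

lemma universal_markov_basis_not_linked: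
  assumes "u \<in> universal_markov_basis A"
  shows "u \<in> kernel_lattice A" and "\<not> linked A (pos_part u) (neg_part u)"
proof -
  obtain M where M: "smallest_markov_basis A M" "u \<in> M \<or> - u \<in> M"
    using assms unfolding universal_markov_basis_eq up_to_sign_iff by blast
  have "M \<subseteq> kernel_lattice A"
    using M(1) unfolding smallest_markov_basis_def markov_basis_def by blast
  then show "u \<in> kernel_lattice A"
    using M(2) kernel_neg[of "- u" A] by auto
  show "\<not> linked A (pos_part u) (neg_part u)"
    using M(2) minimal_markov_basis_not_linked[OF smallest_markov_basis_minimal[OF M(1)]]
      linked_sym by (metis pos_part_uminus neg_part_uminus)
qed

text \<open>Among the moves of a smallest Markov basis choose an inclusion-minimal set connecting \<open>a\<close>
  and \<open>b\<close>. Any move of it that crosses between components is a bridge and can be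
  exchanged for \<open>a - b\<close>.\<close>

lemma not_linked_in_universal_markov_basis:
  assumes ab: "same_fiber A a b" "\<not> linked A a b"
  shows "int_vec a - int_vec b \<in> universal_markov_basis A"
proof -
  obtain M where M: "smallest_markov_basis A M"
    by (rule smallest_markov_basis_exists)
  then have basis: "markov_basis A M" and sub: "M \<subseteq> kernel_lattice A" and fin: "finite M"
    unfolding smallest_markov_basis_def markov_basis_def by blast+
  let ?P = "\<lambda>N. N \<subseteq> M \<and> moves_connect N a b"
  have "?P M"
    using basis ab(1) markov_basis_connect by blast
  define N where "N = (ARG_MIN card N. ?P N)"
  have N: "N \<subseteq> M" "moves_connect N a b"
    using arg_min_natI[of ?P M card, OF \<open>?P M\<close>] unfolding N_def by blast+
  have least: "\<not> moves_connect (N - {v}) a b" if "v \<in> N" for v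
  proof
    assume "moves_connect (N - {v}) a b"
    then have "card N \<le> card (N - {v})"
      using arg_min_nat_le[of ?P "N - {v}" card] N(1) unfolding N_def by blast
    moreover have "card (N - {v}) < card N"
      using that N(1) fin by (meson card_Diff1_less finite_subset)
    ultimately show False by simp
  qed
  have "\<exists>x y. moves_connect N a x \<and> move_step N x y \<and> \<not> linked A x y"
  proof (rule ccontr)
    assume no: "\<not> (\<exists>x y. moves_connect N a x \<and> move_step N x y \<and> \<not> linked A x y)"
    have "linked A a b"
      using N(2)
    proof (induction rule: rtranclp_induct)
      case (step y z)
      then show ?case using no by (metis rtranclp_trans)
    qed simp
    with ab(2) show False ..
  qed
  then obtain x y where xy: "moves_connect N a x" "move_step N x y" "\<not> linked A x y"
    by blast
  obtain v s where v: "v \<in> N" and vs: "{x, y} = {pos_part v + s, neg_part v + s}"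
    using xy(2) by (rule move_step_cases)
  have vL: "v \<in> kernel_lattice A"
    using v N(1) sub by blast
  \<comment> \<open>The ends lie in different components and have disjoint supports, whereas
    \<open>s\<close> is below both of them.\<close>
  have "s = 0"
  proof -
    have "same_fiber A x y"
      using xy(2) N(1) sub by (meson move_step_same_fiber subset_trans)
    then have "disjoint_support x y"
      using xy(3) by (rule disjoint_support_of_not_linked)
    then have "x $ i = 0 \<or> y $ i = 0" for i
      by (simp add: disjoint_support_def)
    moreover have "s $ i \<le> x $ i" "s $ i \<le> y $ i" for i
      using vs by (auto simp: doubleton_eq_iff)
    ultimately have "s $ i = 0" for i
      by (metis le_zero_eq)
    then show ?thesis by (simp add: vec_eq_iff)
  qed
  then have "x = pos_part v \<or> x = neg_part v"
    using vs by (auto simp: doubleton_eq_iff)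
  moreover have "same_fiber A a x"
    using xy(1) N(1) sub by (meson moves_connect_same_fiber subset_trans)
  moreover have vv: "same_fiber A (pos_part v) (neg_part v)"
    using vL same_fiber_parts_iff by blast
  ultimately have av: "same_fiber A a (pos_part v)"
    by (metis same_fiber_sym same_fiber_trans)
  let ?N = "N - {v}"
  \<comment> \<open>Invariant along the path: \<open>z\<close> is reached without \<open>v\<close>,
    or by one crossing of \<open>v\<close> in one of the two directions. Within this fiber only the
    untranslated move \<open>v\<close> can occur, since a translate by nonzero \<open>s\<close> has
    larger degree.\<close>
  have bridge: "moves_connect ?N a z
      \<or> (moves_connect ?N a (pos_part v) \<and> moves_connect ?N (neg_part v) z)
      \<or> (moves_connect ?N a (neg_part v) \<and> moves_connect ?N (pos_part v) z)"
    if "moves_connect N a z" for z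
    using that
  proof (induction rule: rtranclp_induct)
    case (step y z)
    consider "move_step ?N y z" | s where "{y, z} = {pos_part v + s, neg_part v + s}"
      using move_step_remove[OF step.hyps(2), of v] by blast
    then show ?case
    proof cases
      case 1
      then show ?thesis
        using step.IH by (meson rtranclp.rtrancl_into_rtrancl)
    next
      case 2
      have "same_fiber A a y"
        using step.hyps(1) N(1) sub by (meson moves_connect_same_fiber subset_trans)
      moreover have "y = pos_part v + s \<or> y = neg_part v + s"
        using 2 by blast
      ultimately have "s = 0"
        using av vv same_fiber_add_eq_0 by (metis same_fiber_sym same_fiber_trans)
      then consider "y = pos_part v" "z = neg_part v" | "y = neg_part v" "z = pos_part v"
        using 2 by (auto simp: doubleton_eq_iff)
      then show ?thesis
        using step.IH by cases auto
    qed
  qed simp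
  let ?ab = "int_vec a - int_vec b"
  let ?M = "insert ?ab (M - {v})"
  have "?N \<subseteq> ?M"
    using N(1) by blast
  then have lift: "moves_connect ?M p q" if "moves_connect ?N p q" for p q
    using that moves_connect_mono by blast
  have "move_step ?M b a"
    unfolding move_step_def by (intro bexI[of _ ?ab]) auto
  then have ba: "moves_connect ?M b a" "moves_connect ?M a b"
    using moves_connect_sym by blast+
  \<comment> \<open>By minimality of \<open>N\<close> the path needs \<open>v\<close>, so each end
    of \<open>v\<close> is joined to one of \<open>a\<close> and \<open>b\<close> without it; the
    new move closes the gap.\<close>
  have "moves_connect ?M (neg_part v) (pos_part v)"
    using bridge[OF N(2)] least[OF v]
  proof (elim disjE conjE)
    assume "moves_connect ?N a (pos_part v)" "moves_connect ?N (neg_part v) b"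
    then show ?thesis
      using lift ba by (meson rtranclp_trans)
  next
    assume "moves_connect ?N a (neg_part v)" "moves_connect ?N (pos_part v) b"
    then show ?thesis
      using lift ba moves_connect_sym by (meson rtranclp_trans)
  qed blast
  moreover have "?ab \<in> kernel_lattice A"
    using ab(1) same_fiber_iff_diff by blast
  ultimately have "smallest_markov_basis A ?M"
    using smallest_markov_basis_replace[OF M] v N(1) by blast
  then show ?thesis
    unfolding universal_markov_basis_eq up_to_sign_iff by blast
qed

end

section \<open>Sums of inequalities in a term order, and vertices of components\<close>

context term_ord
begin

lemma scale_less:
  assumes "(t, w) \<in> r"
  shows "(k *s t, k *s w) \<in> r"
proof (induction k)
  case (Suc k)
  have Suc_scale: "Suc k *s x = x + k *s x" for x :: "nat ^ 'n"
    by (simp add: vec_eq_iff)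
  show ?case
    unfolding Suc_scale using add_right[OF assms] add_left[OF Suc] trans by blast
qed (simp add: vector_scalar_mult_def)

text \<open>The second conclusion is the strictness: one strict summand makes the whole sum strict.
  It replaces the evaluation of a linear functional on a relation.\<close>

lemma sum_le:
  assumes "finite S" "\<And>s. s \<in> S \<Longrightarrow> (x s, y s) \<in> r"
  shows "(sum x S, sum y S) \<in> r \<and> (sum x S = sum y S \<longrightarrow> (\<forall>s\<in>S. x s = y s))"
  using assms
proof (induction S rule: finite_induct)
  case (insert a S)
  have "(sum x S, sum y S) \<in> r \<and> (sum x S = sum y S \<longrightarrow> (\<forall>s\<in>S. x s = y s))"
    by (rule insert.IH) (rule insert.prems, simp)
  then have IH: "(sum x S, sum y S) \<in> r" "sum x S = sum y S \<Longrightarrow> \<forall>s\<in>S. x s = y s"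
    by simp_all
  have 1: "(x a + sum x S, y a + sum x S) \<in> r"
    using insert.prems[of a] by simp
  have 2: "(y a + sum x S, y a + sum y S) \<in> r"
    using IH(1) by (rule add_left)
  have eq: "x a = y a \<and> sum x S = sum y S" if "x a + sum x S = y a + sum y S"
  proof -
    have "(y a + sum x S, x a + sum x S) \<in> r"
      unfolding that by (rule 2)
    then have "x a + sum x S = y a + sum x S"
      by (rule antisym[OF 1])
    with that show ?thesis by simp
  qed
  show ?case
    unfolding sum.insert[OF insert.hyps]
  proof (intro conjI impI)
    show "(x a + sum x S, y a + sum y S) \<in> r"
      using 1 2 by (rule trans)
    assume "x a + sum x S = y a + sum y S"
    from eq[OF this] show "\<forall>s\<in>insert a S. x s = y s"
      using IH(2) by blast
  qed
qed simp

end

context graded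
begin

text \<open>The hull is that of the whole component although the hypothesis only concerns
  neighbours. This suffices because a nonzero \<open>w\<close> that occurs with positive coefficient
  in a combination equal to \<open>t\<close> has its support inside that of \<open>t\<close>, and so
  is a neighbour.\<close>

lemma minimal_among_neighbours_extreme:
  assumes r: "term_order r" and t0: "t \<noteq> 0"
    and least: "\<And>w. adjacent A t w \<Longrightarrow> (t, w) \<in> r"
  shows "real_vec t extreme_point_of (convex hull (real_vec ` {w. linked A t w}))"
proof -
  interpret term_ord r using r by unfold_locales
  let ?C = "{w. linked A t w}"
  have fin: "finite (?C - {t})"
    using finite_component by simp
  have "real_vec t \<notin> convex hull (real_vec ` (?C - {t}))"
  proof
    assume "real_vec t \<in> convex hull (real_vec ` (?C - {t}))"
    from convex_hull_image_coeffs[OF fin this]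
    obtain l where l_nonneg: "\<forall>w\<in>?C - {t}. 0 \<le> l w" and l: "sum l (?C - {t}) = 1"
      and comb: "real_vec t = (\<Sum>w\<in>?C - {t}. l w *\<^sub>R real_vec w)"
      by (elim exE conjE)
    have t_nth: "real (t $ i) = (\<Sum>w\<in>?C - {t}. l w * real (w $ i))" for i
      using arg_cong[OF comb, of "\<lambda>x. x $ i"] by simp
    have "sum l (?C - {t}) \<noteq> 0"
      using l by simp
    then obtain w0 where w0: "w0 \<in> ?C - {t}" "l w0 \<noteq> 0"
      by (rule sum.not_neutral_contains_not_neutral)
    then have w0_pos: "0 < l w0"
      using l_nonneg w0(1) by (simp add: less_le)
    have "(\<Sum>w\<in>?C - {t}. l w * real_of_int ((int_vec w - int_vec t) $ i)) = 0" for i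
    proof -
      have "(\<Sum>w\<in>?C - {t}. l w * real_of_int ((int_vec w - int_vec t) $ i)) =
          (\<Sum>w\<in>?C - {t}. l w * real (w $ i)) - sum l (?C - {t}) * real (t $ i)"
        by (simp add: right_diff_distrib sum_subtractf sum_distrib_right)
      then show ?thesis
        using t_nth l by simp
    qed
    then have "\<forall>i. (\<Sum>w\<in>?C - {t}. l w * real_of_int ((int_vec w - int_vec t) $ i)) = 0"
      by (rule allI)
    from nonneg_integer_relation[OF fin l_nonneg this w0(1) w0_pos]
    obtain p :: "nat ^ 'n \<Rightarrow> nat"
      where p: "\<forall>i. (\<Sum>w\<in>?C - {t}. int (p w) * (int_vec w - int_vec t) $ i) = 0" "p w0 \<noteq> 0"
        "\<forall>w\<in>?C - {t}. l w = 0 \<longrightarrow> p w = 0"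
      by (elim exE conjE)
    have le: "(t, w) \<in> r" if w: "w \<in> ?C - {t}" "p w \<noteq> 0" for w
    proof -
      have lw: "0 < l w"
        using l_nonneg[rule_format, OF w(1)] p(3)[rule_format, OF w(1)] w(2) by (metis less_eq_real_def)
      have fib: "same_fiber A t w"
        using w(1) linked_same_fiber by blast
      have "w \<noteq> 0"
        using const[OF fib] t0 by auto
      then obtain i where i: "w $ i \<noteq> 0"
        by (auto simp: vec_eq_iff)
      have "0 < l w * real (w $ i)"
        using lw i by simp
      also have "\<dots> \<le> (\<Sum>w\<in>?C - {t}. l w * real (w $ i))"
        using l_nonneg fin w(1) by (intro member_le_sum) auto
      also have "\<dots> = real (t $ i)"
        using t_nth by simp
      finally have "t $ i \<noteq> 0" by simp
      with fib have "adjacent A t w"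
        using i by (rule adjacentI)
      then show ?thesis by (rule least)
    qed
    have "(p w *s t, p w *s w) \<in> r" if w: "w \<in> ?C - {t}" for w
    proof (cases "p w = 0")
      case False
      then show ?thesis using le[OF w] by (intro scale_less)
    qed (simp add: vector_scalar_mult_def)
    with fin have *: "(\<Sum>w\<in>?C - {t}. p w *s t, \<Sum>w\<in>?C - {t}. p w *s w) \<in> r \<and>
        ((\<Sum>w\<in>?C - {t}. p w *s t) = (\<Sum>w\<in>?C - {t}. p w *s w) \<longrightarrow>
          (\<forall>w\<in>?C - {t}. p w *s t = p w *s w))"
      by (rule sum_le)
    \<comment> \<open>The integer relation states exactly this equality, so every summand inequality
      is an equality, in particular the one at \<open>w0\<close>, where \<open>p\<close> is
      nonzero.\<close>
    have "(\<Sum>w\<in>?C - {t}. p w *s t) = (\<Sum>w\<in>?C - {t}. p w *s w)"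
    proof -
      have "int (\<Sum>w\<in>?C - {t}. p w * t $ i) = int (\<Sum>w\<in>?C - {t}. p w * w $ i)" for i
        using p(1)[rule_format, of i] by (simp add: right_diff_distrib sum_subtractf)
      then show ?thesis
        unfolding of_nat_eq_iff by (simp add: vec_eq_iff)
    qed
    from conjunct2[OF *, rule_format, OF this w0(1)]
    have "p w0 *s t = p w0 *s w0" .
    then have "t = w0"
      using p(2) by (simp add: vec_eq_iff)
    with w0(1) show False by blast
  qed
  then have "real_vec t extreme_point_of (convex hull (insert (real_vec t) (real_vec ` (?C - {t}))))"
    using fin by (intro extreme_point_of_convex_hull_insert) auto
  moreover have "insert (real_vec t) (real_vec ` (?C - {t})) = real_vec ` ?C"
    by auto
  ultimately show ?thesis by simp
qed

text \<open>A Markov fiber has two components at least, so any \<open>t\<close> in it is separated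
  from one of the parts of \<open>v\<close>. The difference is a universal Markov move, and the
  hypothesis supplies a term order for it.\<close>

lemma extreme_points_of_markov_subset_groebner:
  assumes sub: "universal_markov_basis A \<subseteq> universal_groebner_basis TYPE('k::field) A"
    and fib: "markov_fiber A u" and t: "t \<in> fiber (kernel_lattice A) u"
  shows "\<exists>P \<in> markov_polyhedra (kernel_lattice A) u. real_vec t extreme_point_of P"
proof -
  obtain v where v: "v \<in> universal_markov_basis A" "same_fiber A (pos_part u) (pos_part v)"
    using fib unfolding markov_fiber_def mem_fiber_iff by blast
  note v' = universal_markov_basis_not_linked[OF v(1)]
  have ut: "same_fiber A (pos_part u) t"
    using t by (simp add: mem_fiber_iff)
  have "same_fiber A t (pos_part v)"
    using ut v(2) by (meson same_fiber_sym same_fiber_trans)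
  moreover from this have "same_fiber A t (neg_part v)"
    using v'(1) same_fiber_parts_iff same_fiber_trans by blast
  moreover have "\<not> linked A t (pos_part v) \<or> \<not> linked A t (neg_part v)"
    using v'(2) by (metis linked_sym rtranclp_trans)
  ultimately obtain s where s: "same_fiber A t s" "\<not> linked A t s"
    by blast
  have "disjoint_support t s"
    using s by (rule disjoint_support_of_not_linked)
  note parts = parts_of_diff[OF this]
  have "int_vec t - int_vec s \<in> universal_groebner_basis TYPE('k) A"
    using not_linked_in_universal_markov_basis[OF s] sub by blast
  then obtain r where r: "term_order r" and "groebner_pair A r t s \<or> groebner_pair A r s t"
    unfolding universal_groebner_basis_iff parts by blast
  \<comment> \<open>As leading exponent, \<open>t\<close> is least among its neighbours; as tail, it
    is least in the entire fiber.\<close>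
  then have "(t, w) \<in> r" if "adjacent A t w" for w
    using that unfolding groebner_pair_def standard_def adjacent_def by blast
  moreover have "t \<noteq> 0"
  proof
    assume "t = 0"
    then have "s = 0"
      using const[OF s(1)] degree_eq_0_iff[of s] by simp
    with \<open>t = 0\<close> s(2) show False by simp
  qed
  ultimately have "real_vec t extreme_point_of (convex hull (real_vec ` {w. linked A t w}))"
    using r by (intro minimal_among_neighbours_extreme)
  then show ?thesis
    unfolding markov_polyhedra_def graph_components_fiber using t by blast
qed

section \<open>Weights adapted to two components of a fiber\<close>

lemma inner_real_vec_affine:
  assumes "\<And>i. c $ i * real (w $ i) = (x $ i + s * y $ i) * real (w $ i)"
  shows "c \<bullet> real_vec w = x \<bullet> real_vec w + s * (y \<bullet> real_vec w)"
proof -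
  have "c \<bullet> real_vec w = (x + s *\<^sub>R y) \<bullet> real_vec w"
    by (simp add: inner_real_vec assms)
  then show ?thesis
    by (simp add: inner_add_left)
qed

lemma eventually_affine_pos:
  fixes x y :: real
  assumes "0 < y"
  shows "eventually (\<lambda>s. 0 < x + s * y) at_top"
  using eventually_gt_at_top[of "- x / y"]
  by eventually_elim (use assms in \<open>simp add: field_simps\<close>)

text \<open>Different components of a fiber have disjoint supports, so weights for them can be chosen
  independently; adding multiples of the grading restricted to the supports then ranks the components.\<close>

lemma groebner_pair_of_extreme_points:
  assumes ab: "same_fiber A a b" "\<not> linked A a b"
    and ext: "real_vec a extreme_point_of (convex hull (real_vec ` {w. linked A a w}))"
      "real_vec b extreme_point_of (convex hull (real_vec ` {w. linked A b w}))"
  obtains r where "term_order r" "groebner_pair A r a b"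
proof -
  obtain c1 where c1: "\<And>w. linked A a w \<Longrightarrow> w \<noteq> a \<Longrightarrow> c1 \<bullet> real_vec a < c1 \<bullet> real_vec w"
    using extreme_point_weight[OF finite_component ext(1)] by (metis mem_Collect_eq)
  obtain c2 where c2: "\<And>w. linked A b w \<Longrightarrow> w \<noteq> b \<Longrightarrow> c2 \<bullet> real_vec b < c2 \<bullet> real_vec w"
    using extreme_point_weight[OF finite_component ext(2)] by (metis mem_Collect_eq)
  define D where "D = d \<bullet> real_vec a"
  have D: "d \<bullet> real_vec w = D" if "same_fiber A a w" for w
    using const[OF that] by (simp add: D_def)
  have "D \<noteq> 0"
  proof
    assume "D = 0"
    then have "a = 0" "b = 0"
      using D[OF ab(1)] unfolding D_def by simp_all
    with ab(2) show False by simp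
  qed
  then have Dpos: "0 < D"
    using degree_nonneg[of a] unfolding D_def by linarith
  define U where "U = {i. \<exists>w. linked A a w \<and> w $ i \<noteq> 0}"
  define V where "V = {i. \<exists>w. linked A b w \<and> w $ i \<noteq> 0}"
  have joined: "linked A x y" if "same_fiber A a x" "same_fiber A a y" "x $ i \<noteq> 0" "y $ i \<noteq> 0" for x y i
  proof -
    have "same_fiber A x y"
      using that(1,2) by (meson same_fiber_sym same_fiber_trans)
    then have "adjacent A x y"
      using that(3,4) by (rule adjacentI)
    then show ?thesis by blast
  qed
  have inU: "linked A a w" if w: "same_fiber A a w" "i \<in> U" "w $ i \<noteq> 0" for w i
  proof -
    obtain x where x: "linked A a x" "x $ i \<noteq> 0"
      using w(2) by (auto simp: U_def)
    have "linked A x w"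
      using joined[of x w i] x w linked_same_fiber by blast
    with x(1) show ?thesis by (rule rtranclp_trans)
  qed
  have inV: "linked A b w" if w: "same_fiber A a w" "i \<in> V" "w $ i \<noteq> 0" for w i
  proof -
    obtain x where x: "linked A b x" "x $ i \<noteq> 0"
      using w(2) by (auto simp: V_def)
    have "same_fiber A a x"
      using ab(1) linked_same_fiber[OF x(1)] by (rule same_fiber_trans)
    then have "linked A x w"
      using joined[of x w i] x w by blast
    with x(1) show ?thesis by (rule rtranclp_trans)
  qed
  have "eventually (\<lambda>s. \<forall>i. 0 < c2 $ i + s * d $ i) at_top"
    by (intro eventually_all_finite eventually_affine_pos pos)
  from eventually_happens'[OF trivial_limit_at_top_linorder this]
  obtain \<beta> where \<beta>: "\<forall>i. 0 < c2 $ i + \<beta> * d $ i" ..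
  \<comment> \<open>The final weight of \<open>b\<close>. It is fixed before \<alpha> is chosen,
    because \<alpha> has to lift the rest of the fiber above it.\<close>
  define m where "m = c2 \<bullet> real_vec b + \<beta> * D"
  \<comment> \<open>The middle conjuncts put \<open>a\<close> and the elements outside both
    components above \<open>b\<close>. The last one, positivity of \<alpha>, is written in the form
    required by \<open>eventually_affine_pos\<close>.\<close>
  have "eventually (\<lambda>s. (\<forall>i. 0 < c1 $ i + s * d $ i) \<and> 0 < (c1 \<bullet> real_vec a - m) + s * D
      \<and> 0 < - m + s * D \<and> 0 < 0 + s * 1) at_top"
    by (intro eventually_conj eventually_all_finite eventually_affine_pos pos Dpos) simp
  from eventually_happens'[OF trivial_limit_at_top_linorder this]
  obtain \<alpha> where "(\<forall>i. 0 < c1 $ i + \<alpha> * d $ i) \<and> 0 < (c1 \<bullet> real_vec a - m) + \<alpha> * D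
      \<and> 0 < - m + \<alpha> * D \<and> 0 < 0 + \<alpha> * 1" ..
  then have \<alpha>: "\<forall>i. 0 < c1 $ i + \<alpha> * d $ i" "m < c1 \<bullet> real_vec a + \<alpha> * D" "m < \<alpha> * D" "0 < \<alpha>"
    by simp_all
  define c where "c = (\<chi> i. if i \<in> V then c2 $ i + \<beta> * d $ i
    else if i \<in> U then c1 $ i + \<alpha> * d $ i else \<alpha> * d $ i)"
  have c_nonneg: "0 \<le> c $ i" for i
    using \<beta>[rule_format, of i] \<alpha>(1)[rule_format, of i] \<alpha>(4) pos[of i] by (simp add: c_def)
  have wV: "c \<bullet> real_vec w = c2 \<bullet> real_vec w + \<beta> * D" if w: "linked A b w" for w
  proof -
    have "same_fiber A a w"
      using ab(1) linked_same_fiber[OF w] by (rule same_fiber_trans)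
    \<comment> \<open>Only the coordinates in the support of \<open>w\<close> count, and all of
      these lie in \<open>V\<close>.\<close>
    have "c $ i * real (w $ i) = (c2 $ i + \<beta> * d $ i) * real (w $ i)" for i
      using w by (cases "w $ i = 0") (auto simp: c_def V_def)
    then have "c \<bullet> real_vec w = c2 \<bullet> real_vec w + \<beta> * (d \<bullet> real_vec w)"
      by (rule inner_real_vec_affine)
    with D[OF \<open>same_fiber A a w\<close>] show ?thesis by simp
  qed
  have wU: "c \<bullet> real_vec w = c1 \<bullet> real_vec w + \<alpha> * D" if w: "linked A a w" for w
  proof -
    have fib: "same_fiber A a w"
      using w by (rule linked_same_fiber)
    have notV: "i \<notin> V" if "w $ i \<noteq> 0" for i
      using inV[OF fib _ that] ab(2) w by (metis linked_sym rtranclp_trans)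
    have "c $ i * real (w $ i) = (c1 $ i + \<alpha> * d $ i) * real (w $ i)" for i
    proof (cases "w $ i = 0")
      case False
      moreover from this have "i \<in> U" using w by (auto simp: U_def)
      ultimately show ?thesis using notV[of i] by (simp add: c_def)
    qed simp
    then have "c \<bullet> real_vec w = c1 \<bullet> real_vec w + \<alpha> * (d \<bullet> real_vec w)"
      by (rule inner_real_vec_affine)
    with D[OF fib] show ?thesis by simp
  qed
  have wO: "c \<bullet> real_vec w = \<alpha> * D"
    if w: "same_fiber A a w" "\<not> linked A a w" "\<not> linked A b w" for w
  proof -
    have "c $ i * real (w $ i) = (0 $ i + \<alpha> * d $ i) * real (w $ i)" for i
      using inU[OF w(1), of i] inV[OF w(1), of i] w by (cases "w $ i = 0") (auto simp: c_def)
    then have "c \<bullet> real_vec w = 0 \<bullet> real_vec w + \<alpha> * (d \<bullet> real_vec w)"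
      by (rule inner_real_vec_affine)
    with D[OF w(1)] show ?thesis by simp
  qed
  have cb: "c \<bullet> real_vec b = m"
    using wV[of b] by (simp add: m_def)
  have b_least: "c \<bullet> real_vec b < c \<bullet> real_vec w" if w: "same_fiber A a w" "w \<noteq> b" for w
  proof -
    consider "linked A b w" | "linked A a w" | "\<not> linked A a w" "\<not> linked A b w" by blast
    then show ?thesis
    proof cases
      case 1
      then show ?thesis using wV[OF 1] wV[of b] c2[OF 1 w(2)] by simp
    next
      case 2
      have "c1 \<bullet> real_vec a \<le> c1 \<bullet> real_vec w"
        using c1[OF 2] by (cases "w = a") auto
      then show ?thesis
        using wU[OF 2] cb \<alpha>(2) by simp
    next
      case 3
      then show ?thesis using wO[OF w(1) 3] cb \<alpha>(3) by simp
    qed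
  qed
  obtain r where r: "term_order r" "\<And>x y. c \<bullet> real_vec x < c \<bullet> real_vec y \<Longrightarrow> (x, y) \<in> r"
    using weight_order_exists[OF c_nonneg] by metis
  interpret term_ord r using r(1) by unfold_locales
  have "standard A r b"
    unfolding standard_def
  proof (intro allI impI)
    fix t assume "same_fiber A b t"
    then have "same_fiber A a t"
      using ab(1) same_fiber_trans by blast
    then show "(b, t) \<in> r"
      using b_least r(2) refl by (cases "t = b") auto
  qed
  moreover have "(a, t) \<in> r" if t: "same_fiber A a t" "\<not> disjoint_support a t" for t
  proof (cases "t = a")
    case False
    have "linked A a t"
      using t disjoint_support_of_not_linked by blast
    then show ?thesis
      using wU[of t] wU[of a] c1[of t] False by (intro r(2)) simp
  qed simp
  moreover have "a \<noteq> b"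
    using ab(2) by auto
  ultimately have "groebner_pair A r a b"
    using ab(1) by (simp add: groebner_pair_def)
  with r(1) show thesis by (rule that)
qed

lemma markov_subset_groebner_of_extreme_points:
  assumes ext: "\<And>u t. u \<in> kernel_lattice A \<Longrightarrow> markov_fiber A u \<Longrightarrow>
      t \<in> fiber (kernel_lattice A) u \<Longrightarrow>
      \<exists>P \<in> markov_polyhedra (kernel_lattice A) u. real_vec t extreme_point_of P"
  shows "universal_markov_basis A \<subseteq> universal_groebner_basis TYPE('k::field) A"
proof
  fix u assume u: "u \<in> universal_markov_basis A"
  note u' = universal_markov_basis_not_linked[OF u]
  let ?a = "pos_part u" and ?b = "neg_part u"
  have ab: "same_fiber A ?a ?b"
    using u'(1) same_fiber_parts_iff by blast
  then have mem: "?a \<in> fiber (kernel_lattice A) u" "?b \<in> fiber (kernel_lattice A) u"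
    by (simp_all add: mem_fiber_iff)
  then have "markov_fiber A u"
    using u unfolding markov_fiber_def by blast
  then have "real_vec t extreme_point_of (convex hull (real_vec ` {w. linked A t w}))"
    if "t \<in> fiber (kernel_lattice A) u" for t
    using ext[OF u'(1) _ that] extreme_point_of_component by blast
  then obtain r where "term_order r" "groebner_pair A r ?a ?b"
    using groebner_pair_of_extreme_points[OF ab u'(2)] mem by metis
  then show "u \<in> universal_groebner_basis TYPE('k) A"
    unfolding universal_groebner_basis_iff by blast
qed

end

theorem theorem2p7:
  fixes A :: "int ^ 'n ^ 'm"
  shows "universal_markov_basis A \<subseteq> universal_groebner_basis TYPE('k::field) A \<longleftrightarrow>
    (positive_lattice (kernel_lattice A) \<and>
      (\<forall>u \<in> kernel_lattice A. markov_fiber A u \<longrightarrow>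
        (\<forall>t \<in> fiber (kernel_lattice A) u.
          \<exists>P \<in> markov_polyhedra (kernel_lattice A) u. real_vec t extreme_point_of P))) \<or>
    (kernel_lattice A = pure_sublattice (kernel_lattice A) \<and>
      lattice_rank (kernel_lattice A) = 1)"
  (is "?sub \<longleftrightarrow> (?pos \<and> ?ext) \<or> ?cyclic")
proof (cases ?pos)
  case True
  then obtain d :: "real ^ 'n" where d: "\<forall>j. 0 < d $ j"
    "\<forall>a b. same_fiber A a b \<longrightarrow> d \<bullet> real_vec a = d \<bullet> real_vec b"
    by (rule positive_grading_exists)
  interpret graded A d
    by unfold_locales (use d in auto)
  \<comment> \<open>The cyclic condition implies the inclusion for every lattice, so this
    equivalence settles the positive case.\<close>
  have "?sub \<longleftrightarrow> ?ext"
    using extreme_points_of_markov_subset_groebner[where 'k = 'k]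
      markov_subset_groebner_of_extreme_points[where 'k = 'k] by blast
  then show ?thesis
    using True cyclic_imp_markov_subset_groebner[of A, where 'k = 'k] by blast
next
  case False
  then show ?thesis
    using nonpositive_imp_cyclic[of A, where 'k = 'k]
      cyclic_imp_markov_subset_groebner[of A, where 'k = 'k] by blast
qed

end
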